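(* Let $V_i(t)$, $t\in\mathbb R$, $i=1,2$, be two centered Gaussian processes with stationary increments, continuous sample paths, and variograms $\gamma_{V_i}$, $i=1,2$. If for some $T>0$ $$\gamma_{V_1}(t)\le\gamma_{V_2}(t)\qquad\text{for all }t\in[0,T],$$ then $$\mathcal G_{V_1}(T)\ge\mathcal G_{V_2}(T),\qquad\mathcal H_{V_1}(T)\le\mathcal H_{V_2}(T).$$
   Context: For a centered Gaussian process $V$ with stationary increments and variance function $\sigma_V^2(t)=\operatorname{Var}(V(t))$, the variogram is $\gamma_V(h)=\frac12\mathbb E\{(V(h)-V(0))^2\}$, and $$\mathcal G_V(T)=\mathbb E\Big\{\inf_{t\in[0,T]}e^{\sqrt2V(t)-\sigma_V^2(t)}\Big\},\qquad\mathcal H_V(T)=\mathbb E\Big\{\sup_{t\in[0,T]}e^{\sqrt2V(t)-\sigma_V^2(t)}\Big\}.$$ Note that $V(0)$ is not assumed to be zero. *)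

theory Defs
  imports "HOL-Probability.Probability"
begin

(* Point masses count as normal laws: increments over distance 0 are degenerate, and so may be
   any other linear combination of the values of the process. *)
definition gaussian_law :: "real measure \<Rightarrow> bool" where
  "gaussian_law \<mu> \<longleftrightarrow>
     (\<exists>m. \<mu> = return borel m) \<or>
     (\<exists>m s. 0 < s \<and> \<mu> = density lborel (\<lambda>x. ennreal (normal_density m s x)))"

(* Joint normality of the finite-dimensional distributions: all finite linear combinations
   are normal. *)
definition gaussian_process :: "'a measure \<Rightarrow> (real \<Rightarrow> 'a \<Rightarrow> real) \<Rightarrow> bool" where
  "gaussian_process M V \<longleftrightarrow>
     (\<forall>t. V t \<in> borel_measurable M) \<and>
     (\<forall>J c. finite J \<longrightarrow> gaussian_law (distr M borel (\<lambda>\<omega>. \<Sum>t\<in>J. c t * V t \<omega>)))"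

definition centered_process :: "'a measure \<Rightarrow> (real \<Rightarrow> 'a \<Rightarrow> real) \<Rightarrow> bool" where
  "centered_process M V \<longleftrightarrow>
     (\<forall>t. integrable M (V t) \<and> prob_space.expectation M (V t) = 0)"

(* The law of the process (V (t + h) - V h) indexed by t, as a measure on the product
   sigma-algebra, does not depend on h. *)
definition stationary_increments :: "'a measure \<Rightarrow> (real \<Rightarrow> 'a \<Rightarrow> real) \<Rightarrow> bool" where
  "stationary_increments M V \<longleftrightarrow>
     (\<forall>h. distr M (Pi\<^sub>M UNIV (\<lambda>_. borel)) (\<lambda>\<omega> t. V (t + h) \<omega> - V h \<omega>) =
          distr M (Pi\<^sub>M UNIV (\<lambda>_. borel)) (\<lambda>\<omega> t. V t \<omega> - V 0 \<omega>))"

definition continuous_paths :: "'a measure \<Rightarrow> (real \<Rightarrow> 'a \<Rightarrow> real) \<Rightarrow> bool" where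
  "continuous_paths M V \<longleftrightarrow> (\<forall>\<omega>\<in>space M. continuous_on UNIV (\<lambda>t. V t \<omega>))"

definition variogram :: "'a measure \<Rightarrow> (real \<Rightarrow> 'a \<Rightarrow> real) \<Rightarrow> real \<Rightarrow> real" where
  "variogram M V h = 1 / 2 * prob_space.expectation M (\<lambda>\<omega>. (V h \<omega> - V 0 \<omega>)\<^sup>2)"

(* The two functionals are expectations of nonnegative quantities, taken in [0, \<infinity>] so that no
   integrability has to be presupposed. *)
definition inf_functional :: "'a measure \<Rightarrow> (real \<Rightarrow> 'a \<Rightarrow> real) \<Rightarrow> real \<Rightarrow> ennreal" where
  "inf_functional M V T =
     (\<integral>\<^sup>+ \<omega>. (INF t\<in>{0..T}. ennreal (exp (sqrt 2 * V t \<omega> - prob_space.variance M (V t)))) \<partial>M)"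

definition sup_functional :: "'a measure \<Rightarrow> (real \<Rightarrow> 'a \<Rightarrow> real) \<Rightarrow> real \<Rightarrow> ennreal" where
  "sup_functional M V T =
     (\<integral>\<^sup>+ \<omega>. (SUP t\<in>{0..T}. ennreal (exp (sqrt 2 * V t \<omega> - prob_space.variance M (V t)))) \<partial>M)"

end

theory Submission
  imports Defs "HOL-Real_Asymp.Real_Asymp"
begin

text \<open>
  Put both processes on the product space, so that they are independent, and restrict them to a
  finite set of times. With \<open>X\<close>, \<open>Y\<close> the restrictions of \<open>V\<^sub>1\<close>, \<open>V\<^sub>2\<close>, let
  \<open>Z(\<theta>) = cos \<theta> X + sin \<theta> Y\<close> and, for \<open>p \<noteq> 0\<close>,
  \<open>h(\<theta>) = E (\<Sum>\<^sub>i exp (p (sqrt 2 Z\<^sub>i(\<theta>) - Var Z\<^sub>i(\<theta>)))) powr (1 / p)\<close>.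
  Gaussian integration by parts gives
  \<open>h'(\<theta>) = sin \<theta> cos \<theta> (p - 1) E [F \<Sum>\<^sub>i\<^sub>j w\<^sub>i w\<^sub>j (Var (Y\<^sub>i - Y\<^sub>j) - Var (X\<^sub>i - X\<^sub>j))]\<close>
  with \<open>F > 0\<close> and weights \<open>w \<ge> 0\<close>. The variances themselves cancel, because \<open>\<Sum> w\<^sub>i = 1\<close> and
  they are subtracted in the exponent; only variances of increments, that is, variograms, remain.
  Hence \<open>h\<close> increases on \<open>[0, \<pi>/2]\<close> for \<open>p > 1\<close> and decreases for \<open>p < 0\<close>. Letting \<open>p\<close> tend to
  \<open>\<infinity>\<close> and to \<open>-\<infinity>\<close> yields the comparison of maxima and of minima over finite sets of times, and
  path continuity extends it to \<open>[0, T]\<close>.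
\<close>

section \<open>The Cramer-Wold theorem\<close>

text \<open>Normality is given only through the laws of linear combinations, and these may be
  degenerate. There is no joint density to differentiate in \<theta>, so one variable at a time is
  integrated by parts while the others are frozen. This requires independence of suitable
  combinations, and independence has to be read off from characteristic functions; that is the
  purpose of the Cramer-Wold theorem.

  The factor \<open>p - 1\<close> can be foreseen. For \<open>p = 1\<close> the mean is a plain sum
  of exponentials, each of expectation 1 because E exp (sqrt 2 Z) = exp (Var Z), so the
  interpolating function is constant in \<theta>.

  The passage to \<open>[0, T]\<close> is not symmetric in the two claims. Suprema over growing
  finite sets increase, whereas infima decrease, and decreasing limits of integrals call for a
  finite integral. Moreover, the exponent contains the variance as a function of time, whose
  continuity has to be derived from that of the paths.\<close>

lemma distr_weighted:
  fixes W :: "'a \<Rightarrow> real" and X :: "'a \<Rightarrow> real"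
  assumes "prob_space M" and X[measurable]: "X \<in> borel_measurable M" and W: "integrable M W" 
    and W0: "\<And>x. 0 \<le> W x" and m: "m = (\<integral>x. W x \<partial>M)" "m > 0"
  defines "D \<equiv> distr (density M (\<lambda>x. ennreal (W x / m))) borel X"
  shows "real_distribution D"
    and "char D t = Complex ((\<integral>x. W x * cos (t * X x) \<partial>M) / m) ((\<integral>x. W x * sin (t * X x) \<partial>M) / m)"
    and "B \<in> sets borel \<Longrightarrow> measure D B = (\<integral>x. W x * indicator B (X x) \<partial>M) / m"
proof -
  have Wm[measurable]: "W \<in> borel_measurable M" using W by auto
  interpret M: prob_space M by fact
  interpret P: prob_space "density M (\<lambda>x. ennreal (W x / m))"
  proof
    have "(\<integral>\<^sup>+x. ennreal (W x / m) \<partial>M) = ennreal (\<integral>x. W x / m \<partial>M)"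
      using W W0 m by (intro nn_integral_eq_integral) auto
    also have "\<dots> = 1" using m by simp
    finally show "emeasure (density M (\<lambda>x. ennreal (W x / m))) (space (density M (\<lambda>x. ennreal (W x / m)))) = 1"
      by (simp add: emeasure_density)
  qed
  show rd: "real_distribution D" unfolding D_def by (intro P.real_distribution_distr) simp
  have "char D t = (\<integral>x. complex_of_real (W x / m) * iexp (t * X x) \<partial>M)"
    unfolding char_def D_def
    using m W0 by (simp add: integral_distr integral_density scaleR_conv_of_real)
  also have "\<dots> = (\<integral>x. complex_of_real (W x * cos (t * X x) / m) + \<i> * complex_of_real (W x * sin (t * X x) / m) \<partial>M)"
    by (intro Bochner_Integration.integral_cong) (auto simp: complex_eq_iff exp_of_real[symmetric] Re_exp Im_exp)
  also have "\<dots> = Complex ((\<integral>x. W x * cos (t * X x) \<partial>M) / m) ((\<integral>x. W x * sin (t * X x) \<partial>M) / m)"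
  proof -
    have 1: "integrable M (\<lambda>x. W x * cos (t * X x))"
      by (rule Bochner_Integration.integrable_bound[OF W]) (auto intro!: mult_left_le simp: abs_mult)
    have 2: "integrable M (\<lambda>x. W x * sin (t * X x))"
      by (rule Bochner_Integration.integrable_bound[OF W]) (auto intro!: mult_left_le simp: abs_mult)
    have 3: "integrable M (\<lambda>x. complex_of_real (W x * cos (t * X x) / m))"
      "integrable M (\<lambda>x. \<i> * complex_of_real (W x * sin (t * X x) / m))"
      using 1 2 by (auto intro!: integrable_of_real simp del: of_real_divide of_real_mult)
    show ?thesis
      apply (subst Bochner_Integration.integral_add[OF 3])
      using 1 2 by (simp add: complex_eq_iff del: of_real_divide of_real_mult)
  qed
  finally show "char D t = Complex ((\<integral>x. W x * cos (t * X x) \<partial>M) / m) ((\<integral>x. W x * sin (t * X x) \<partial>M) / m)" .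
  interpret D: real_distribution D by fact
  show "measure D B = (\<integral>x. W x * indicator B (X x) \<partial>M) / m" if [measurable]: "B \<in> sets borel"
  proof -
    have "measure D B = (\<integral>x. indicator B x \<partial>D)" using D.events_eq_borel by simp
    also have "\<dots> = (\<integral>x. (W x / m) * indicator B (X x) \<partial>M)"
      unfolding D_def using m W0 by (subst integral_distr; simp add: integral_density)
    finally show ?thesis by simp
  qed
qed

text \<open>Dividing by the common total mass makes both weights probability densities; the laws of
  \<open>X\<close> and \<open>X'\<close> under them have the same characteristic function, and
  Levy's theorem identifies them. Normalization is possible because the weights are nonnegative, a
  constraint that shapes the induction below.\<close>

lemma weighted_Levy_uniqueness:
  fixes W X :: "'a \<Rightarrow> real" and W' X' :: "'b \<Rightarrow> real"
  assumes M: "prob_space M" and N: "prob_space N"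
    and X: "X \<in> borel_measurable M" and W: "integrable M W" and W0: "\<And>x. 0 \<le> W x"
    and X': "X' \<in> borel_measurable N" and W': "integrable N W'" and W0': "\<And>x. 0 \<le> W' x"
    and c: "\<And>t. (\<integral>x. W x * cos (t * X x) \<partial>M) = (\<integral>x. W' x * cos (t * X' x) \<partial>N)"
    and s: "\<And>t. (\<integral>x. W x * sin (t * X x) \<partial>M) = (\<integral>x. W' x * sin (t * X' x) \<partial>N)"
    and B: "B \<in> sets borel"
  shows "(\<integral>x. W x * indicator B (X x) \<partial>M) = (\<integral>x. W' x * indicator B (X' x) \<partial>N)"
proof -
  define m where "m = (\<integral>x. W x \<partial>M)"
  \<comment> \<open>At \<open>t = 0\<close> the cosine identity compares the total masses.\<close>
  have m': "m = (\<integral>x. W' x \<partial>N)" using c[of 0] by (simp add: m_def)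
  have "m \<ge> 0" unfolding m_def using W0 by simp
  then consider "m = 0" | "m > 0" by linarith
  then show ?thesis
  proof cases
    \<comment> \<open>A weight of mass zero cannot be normalized, but it vanishes almost
      everywhere.\<close>
    case 1
    then have "AE x in M. W x = 0" "AE x in N. W' x = 0"
      using integral_nonneg_eq_0_iff_AE[OF W] integral_nonneg_eq_0_iff_AE[OF W'] W0 W0' m_def m' by auto
    then have "AE x in M. W x * indicator B (X x) = 0" "AE x in N. W' x * indicator B (X' x) = 0"
      by (auto elim!: AE_mp)
    then have "(\<integral>x. W x * indicator B (X x) \<partial>M) = 0" "(\<integral>x. W' x * indicator B (X' x) \<partial>N) = 0"
      by (auto intro!: integral_eq_zero_AE)
    then show ?thesis by simp
  next
    case 2
    note D = distr_weighted[OF M X W W0 m_def 2] and D' = distr_weighted[OF N X' W' W0' m' 2]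
    have "distr (density M (\<lambda>x. ennreal (W x / m))) borel X = distr (density N (\<lambda>x. ennreal (W' x / m))) borel X'"
      by (rule Levy_uniqueness[OF D(1) D'(1)]) (simp add: fun_eq_iff D(2) D'(2) c s)
    then show ?thesis using D(3)[OF B] D'(3)[OF B] 2 by simp
  qed
qed

text \<open>
  Coordinates are turned into indicators one at a time. The cosine factor has no sign, so the
  one-dimensional uniqueness theorem is applied to the nonnegative weight with \<open>1 + cos\<close> in its
  place and to the weight without it, and the difference is taken.
\<close>

lemma cramer_wold_indicator_cos:
  fixes X :: "'i \<Rightarrow> 'a \<Rightarrow> real" and Y :: "'i \<Rightarrow> 'b \<Rightarrow> real"
  assumes M: "prob_space M" and N: "prob_space N" and J: "finite J"
    and X: "\<And>j. j \<in> J \<Longrightarrow> X j \<in> borel_measurable M" and Y: "\<And>j. j \<in> J \<Longrightarrow> Y j \<in> borel_measurable N"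
    and eq: "\<And>c. (\<integral>x. cos (\<Sum>j\<in>J. c j * X j x) \<partial>M) = (\<integral>x. cos (\<Sum>j\<in>J. c j * Y j x) \<partial>N)"
            "\<And>c. (\<integral>x. sin (\<Sum>j\<in>J. c j * X j x) \<partial>M) = (\<integral>x. sin (\<Sum>j\<in>J. c j * Y j x) \<partial>N)"
    and "A \<subseteq> J" and B: "\<And>j. j \<in> A \<Longrightarrow> B j \<in> sets borel"
  shows "(\<integral>x. (\<Prod>j\<in>A. indicator (B j) (X j x)) * cos ((\<Sum>j\<in>J. c j * X j x) + p) \<partial>M)
       = (\<integral>x. (\<Prod>j\<in>A. indicator (B j) (Y j x)) * cos ((\<Sum>j\<in>J. c j * Y j x) + p) \<partial>N)"
proof -
  interpret M: prob_space M by fact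
  interpret N: prob_space N by fact
  note [measurable] = X Y
  have int1: "integrable M (\<lambda>x. f x * g x)" if "f \<in> borel_measurable M" "g \<in> borel_measurable M"
     "\<And>x. \<bar>f x\<bar> \<le> 1" "\<And>x. \<bar>g x\<bar> \<le> 1" for f g :: "'a \<Rightarrow> real"
    by (rule M.integrable_const_bound[where B=1]) (use that in \<open>auto simp: abs_mult intro!: mult_le_one\<close>)
  have int2: "integrable N (\<lambda>x. f x * g x)" if "f \<in> borel_measurable N" "g \<in> borel_measurable N"
     "\<And>x. \<bar>f x\<bar> \<le> 1" "\<And>x. \<bar>g x\<bar> \<le> 1" for f g :: "'b \<Rightarrow> real"
    by (rule N.integrable_const_bound[where B=1]) (use that in \<open>auto simp: abs_mult intro!: mult_le_one\<close>)
  have "finite A" using \<open>A \<subseteq> J\<close> J finite_subset by blast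
  then show ?thesis using \<open>A \<subseteq> J\<close> B
  \<comment> \<open>\<open>c\<close> and the phase \<open>p\<close> stay general: converting
    coordinate \<open>k\<close> calls the hypothesis with a shifted \<open>c k\<close> and with
    other phases.\<close>
  proof (induction A arbitrary: c p rule: finite_induct)
    case empty
    have 1: "integrable M (\<lambda>x. cos p * cos (\<Sum>j\<in>J. c j * X j x))" "integrable M (\<lambda>x. sin p * sin (\<Sum>j\<in>J. c j * X j x))"
      by (intro int1; simp; fail)+
    have 2: "integrable N (\<lambda>x. cos p * cos (\<Sum>j\<in>J. c j * Y j x))" "integrable N (\<lambda>x. sin p * sin (\<Sum>j\<in>J. c j * Y j x))"
      by (intro int2; simp; fail)+
    show ?case using Bochner_Integration.integral_diff[OF 1] Bochner_Integration.integral_diff[OF 2] eq[of c]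
      by (simp add: cos_add mult.commute)
  next
    case (insert k A)
    have k: "k \<in> J" and AJ: "A \<subseteq> J" using insert by auto
    have Bk[measurable]: "B k \<in> sets borel" using insert by auto
    have BA[measurable]: "\<And>j. j \<in> A \<Longrightarrow> B j \<in> sets borel" using insert by auto
    have IH: "(\<integral>x. (\<Prod>j\<in>A. indicator (B j) (X j x)) * cos ((\<Sum>j\<in>J. c j * X j x) + p) \<partial>M)
            = (\<integral>x. (\<Prod>j\<in>A. indicator (B j) (Y j x)) * cos ((\<Sum>j\<in>J. c j * Y j x) + p) \<partial>N)" for c p
      using insert by auto
    define P where "P x = (\<Prod>j\<in>A. indicator (B j) (X j x) :: real)" for x
    define Q where "Q x = (\<Prod>j\<in>A. indicator (B j) (Y j x) :: real)" for x
    have PM[measurable]: "P \<in> borel_measurable M" "Q \<in> borel_measurable N"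
      unfolding P_def Q_def using AJ by (auto intro!: borel_measurable_prod)
    have P01: "0 \<le> P x" "P x \<le> 1" "0 \<le> Q y" "Q y \<le> 1" for x y unfolding P_def Q_def
      by (auto intro!: prod_nonneg prod_le_1)
    define S where "S c x = (\<Sum>j\<in>J. c j * X j x)" for c x
    define R where "R c x = (\<Sum>j\<in>J. c j * Y j x)" for c x
    have [measurable]: "S c \<in> borel_measurable M" "R c \<in> borel_measurable N" for c unfolding S_def R_def by auto
    \<comment> \<open>In all uses \<open>a\<close> is 0 or 1: the old combination is switched off or
      kept while a multiple of coordinate \<open>k\<close> is added, and the result is again a
      combination over \<open>J\<close>.\<close>
    have upd: "S (\<lambda>j. a * c j + (if j = k then t else 0)) x = a * S c x + t * X k x"
      "R (\<lambda>j. a * c j + (if j = k then t else 0)) y = a * R c y + t * Y k y" for a c t x y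
      using k J by (simp_all add: S_def R_def distrib_right sum.distrib sum_distrib_left if_distrib[of "\<lambda>u. u * _"] mult.assoc cong: if_cong)
    have IH': "(\<integral>x. P x * cos (S c x + p) \<partial>M) = (\<integral>x. Q x * cos (R c x + p) \<partial>N)" for c p
      using IH by (simp add: P_def Q_def S_def R_def)
    have IH2: "(\<integral>x. P x * cos (a * S c x + t * X k x + p) \<partial>M) = (\<integral>x. Q x * cos (a * R c x + t * Y k x + p) \<partial>N)" for a t p c
      using IH'[of "\<lambda>j. a * c j + (if j = k then t else 0)" p] by (simp add: upd)
    have intX: "integrable M (\<lambda>x. P x * cos (a * S c x + t * X k x + p))" "integrable M (\<lambda>x. P x * indicator (B k) (X k x))"
        "integrable M (\<lambda>x. P x * (indicator (B k) (X k x) * cos (S c x + p)))" for a c t p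
      by (intro int1; (use P01 k in \<open>auto simp: abs_mult indicator_def\<close>); fail)+
    have intY: "integrable N (\<lambda>x. Q x * cos (a * R c x + t * Y k x + p))" "integrable N (\<lambda>x. Q x * indicator (B k) (Y k x))"
        "integrable N (\<lambda>x. Q x * (indicator (B k) (Y k x) * cos (R c x + p)))" for a c t p
      by (intro int2; (use P01 k in \<open>auto simp: abs_mult indicator_def\<close>); fail)+
    \<comment> \<open>The product formula for cosines turns weight times test function into three
      terms, each covered by the induction hypothesis. Here \<open>b\<close> is 0 for the plain
      weight and 1 for the shifted one; the phase \<open>r\<close> is there to include
      sines.\<close>
    have trig: "P x * (1 + b * cos (S c x + p)) * cos (t * X k x + r)
       = P x * cos (0 * S c x + t * X k x + r) + b / 2 * (P x * cos (1 * S c x + t * X k x + (p + r)))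
          + b / 2 * (P x * cos (1 * S c x + (- t) * X k x + (p - r)))" 
      "Q y * (1 + b * cos (R c y + p)) * cos (t * Y k y + r)
       = Q y * cos (0 * R c y + t * Y k y + r) + b / 2 * (Q y * cos (1 * R c y + t * Y k y + (p + r)))
          + b / 2 * (Q y * cos (1 * R c y + (- t) * Y k y + (p - r)))" for x y b c p t r
    proof -
      have *: "w * (1 + b * cos (s + p)) * cos (u + r)
       = w * cos (0 * s + u + r) + b / 2 * (w * cos (1 * s + u + (p + r)))
          + b / 2 * (w * cos (1 * s - u + (p - r)))" for w s u :: real
      proof -
        have "cos (s + p) * cos (u + r) = (cos (1 * s - u + (p - r)) + cos (1 * s + u + (p + r))) / 2"
          by (subst cos_times_cos) (simp add: algebra_simps)
        then have "w * (b * (cos (s + p) * cos (u + r))) = w * (b * ((cos (1 * s - u + (p - r)) + cos (1 * s + u + (p + r))) / 2))"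
          by simp
        then show ?thesis by (simp add: algebra_simps add_divide_distrib)
      qed
      show "P x * (1 + b * cos (S c x + p)) * cos (t * X k x + r)
       = P x * cos (0 * S c x + t * X k x + r) + b / 2 * (P x * cos (1 * S c x + t * X k x + (p + r)))
          + b / 2 * (P x * cos (1 * S c x + (- t) * X k x + (p - r)))"
        "Q y * (1 + b * cos (R c y + p)) * cos (t * Y k y + r)
       = Q y * cos (0 * R c y + t * Y k y + r) + b / 2 * (Q y * cos (1 * R c y + t * Y k y + (p + r)))
          + b / 2 * (Q y * cos (1 * R c y + (- t) * Y k y + (p - r)))"
        using *[of "P x" "S c x" "t * X k x"] *[of "Q y" "R c y" "t * Y k y"] by simp_all
    qed
    have eqc: "(\<integral>x. P x * (1 + b * cos (S c x + p)) * cos (t * X k x + r) \<partial>M)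
             = (\<integral>x. Q x * (1 + b * cos (R c x + p)) * cos (t * Y k x + r) \<partial>N)" for b c p t r
      unfolding trig
      by (simp only: Bochner_Integration.integral_add Bochner_Integration.integrable_add
        integrable_mult_right integral_mult_right_zero intX intY IH2)
    have ind: "(\<integral>x. P x * (1 + b * cos (S c x + p)) * indicator (B k) (X k x) \<partial>M)
             = (\<integral>x. Q x * (1 + b * cos (R c x + p)) * indicator (B k) (Y k x) \<partial>N)" if b: "b = 0 \<or> b = 1" for b c p
    proof (rule weighted_Levy_uniqueness[OF M N X[OF k] _ _ Y[OF k]])
      have **: "0 \<le> 1 + cos u" for u::real using cos_ge_minus_one[of u] by linarith
      show "integrable M (\<lambda>x. P x * (1 + b * cos (S c x + p)))"
        using intX(1)[of 0 c 0 0] intX(1)[of 1 c 0 p] b by (auto simp: distrib_left)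
      show "integrable N (\<lambda>x. Q x * (1 + b * cos (R c x + p)))"
        using intY(1)[of 0 c 0 0] intY(1)[of 1 c 0 p] b by (auto simp: distrib_left)
      show "0 \<le> P x * (1 + b * cos (S c x + p))" "0 \<le> Q y * (1 + b * cos (R c y + p))" for x y
        using P01 b ** by auto
      show "(\<integral>x. P x * (1 + b * cos (S c x + p)) * cos (t * X k x) \<partial>M)
             = (\<integral>x. Q x * (1 + b * cos (R c x + p)) * cos (t * Y k x) \<partial>N)" for t
        using eqc[of b c p t 0] by simp
      \<comment> \<open>A sine is a cosine with phase \<open>- (pi / 2)\<close>, so
        \<open>eqc\<close> covers it.\<close>
      have sin: "sin u = cos (u + - (pi / 2))" for u :: real by (simp add: cos_diff)
      show "(\<integral>x. P x * (1 + b * cos (S c x + p)) * sin (t * X k x) \<partial>M)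
             = (\<integral>x. Q x * (1 + b * cos (R c x + p)) * sin (t * Y k x) \<partial>N)" for t
        unfolding sin[of "t * _"] by (rule eqc)
    qed simp
    have "(\<integral>x. P x * indicator (B k) (X k x) + P x * (indicator (B k) (X k x) * cos (S c x + p)) \<partial>M)
             = (\<integral>x. Q x * indicator (B k) (Y k x) + Q x * (indicator (B k) (Y k x) * cos (R c x + p)) \<partial>N)"
      using ind[of 1 c p] by (simp add: algebra_simps)
    moreover have "(\<integral>x. P x * indicator (B k) (X k x) \<partial>M) = (\<integral>x. Q x * indicator (B k) (Y k x) \<partial>N)"
      using ind[of 0 c p] by simp
    ultimately have "(\<integral>x. P x * (indicator (B k) (X k x) * cos (S c x + p)) \<partial>M)
             = (\<integral>x. Q x * (indicator (B k) (Y k x) * cos (R c x + p)) \<partial>N)"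
      by (simp add: Bochner_Integration.integral_add[OF intX(2,3)] Bochner_Integration.integral_add[OF intY(2,3)])
    then show ?case using insert(1,2) by (simp add: P_def Q_def S_def R_def mult_ac)
  qed
qed

lemma cramer_wold:
  fixes X :: "'i \<Rightarrow> 'a \<Rightarrow> real" and Y :: "'i \<Rightarrow> 'b \<Rightarrow> real"
  assumes M: "prob_space M" and N: "prob_space N" and J: "finite J"
    and X: "\<And>j. j \<in> J \<Longrightarrow> X j \<in> borel_measurable M" and Y: "\<And>j. j \<in> J \<Longrightarrow> Y j \<in> borel_measurable N"
    and eq: "\<And>c. (\<integral>x. iexp (\<Sum>j\<in>J. c j * X j x) \<partial>M) = (\<integral>x. iexp (\<Sum>j\<in>J. c j * Y j x) \<partial>N)"
  shows "distr M (Pi\<^sub>M J (\<lambda>_. borel)) (\<lambda>x. \<lambda>j\<in>J. X j x) = distr N (Pi\<^sub>M J (\<lambda>_. borel)) (\<lambda>x. \<lambda>j\<in>J. Y j x)"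
proof (rule measure_eqI_PiM_finite[OF J])
  interpret M: prob_space M by fact
  interpret N: prob_space N by fact
  note [measurable] = X Y
  have iM: "integrable M (\<lambda>x. iexp (\<Sum>j\<in>J. c j * X j x))" for c
    by (rule M.integrable_const_bound[where B=1]) auto
  have iN: "integrable N (\<lambda>x. iexp (\<Sum>j\<in>J. c j * Y j x))" for c
    by (rule N.integrable_const_bound[where B=1]) auto
  have cos: "(\<integral>x. cos (\<Sum>j\<in>J. c j * X j x) \<partial>M) = (\<integral>x. cos (\<Sum>j\<in>J. c j * Y j x) \<partial>N)" for c
    using arg_cong[OF eq[of c], of Re] integral_Re[OF iM, of c] integral_Re[OF iN, of c] by (simp add: Re_exp del: of_real_sum of_real_mult)
  have sin: "(\<integral>x. sin (\<Sum>j\<in>J. c j * X j x) \<partial>M) = (\<integral>x. sin (\<Sum>j\<in>J. c j * Y j x) \<partial>N)" for c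
    using arg_cong[OF eq[of c], of Im] integral_Im[OF iM, of c] integral_Im[OF iN, of c] by (simp add: Im_exp del: of_real_sum of_real_mult)
  show "emeasure (distr M (Pi\<^sub>M J (\<lambda>_. borel)) (\<lambda>x. \<lambda>j\<in>J. X j x)) (Pi\<^sub>E J B) = emeasure (distr N (Pi\<^sub>M J (\<lambda>_. borel)) (\<lambda>x. \<lambda>j\<in>J. Y j x)) (Pi\<^sub>E J B)"
    if B: "\<And>j. j \<in> J \<Longrightarrow> B j \<in> sets borel" for B
  proof -
    have [measurable]: "Pi\<^sub>E J B \<in> sets (Pi\<^sub>M J (\<lambda>_. borel))" using J B by (auto intro: sets_PiM_I_finite)
    have 1: "measure M ((\<lambda>x. \<lambda>j\<in>J. X j x) -` Pi\<^sub>E J B \<inter> space M) = (\<integral>x. (\<Prod>j\<in>J. indicator (B j) (X j x)) \<partial>M)"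
    proof -
      have "(\<integral>x. (\<Prod>j\<in>J. indicator (B j) (X j x)) \<partial>M) = (\<integral>x. (indicator ((\<lambda>x. \<lambda>j\<in>J. X j x) -` Pi\<^sub>E J B \<inter> space M) x :: real) \<partial>M)"
        using J by (intro Bochner_Integration.integral_cong) (auto simp: indicator_def PiE_iff intro!: prod.neutral)
      then show ?thesis by simp
    qed
    have 2: "measure N ((\<lambda>x. \<lambda>j\<in>J. Y j x) -` Pi\<^sub>E J B \<inter> space N) = (\<integral>x. (\<Prod>j\<in>J. indicator (B j) (Y j x)) \<partial>N)"
    proof -
      have "(\<integral>x. (\<Prod>j\<in>J. indicator (B j) (Y j x)) \<partial>N) = (\<integral>x. (indicator ((\<lambda>x. \<lambda>j\<in>J. Y j x) -` Pi\<^sub>E J B \<inter> space N) x :: real) \<partial>N)"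
        using J by (intro Bochner_Integration.integral_cong) (auto simp: indicator_def PiE_iff intro!: prod.neutral)
      then show ?thesis by simp
    qed
    \<comment> \<open>With every coordinate turned into an indicator and \<open>c\<close>,
      \<open>p\<close> equal to zero, the cosine is 1 and the integral is the probability of the
      rectangle.\<close>
    show ?thesis
      using cramer_wold_indicator_cos[OF M N J X Y cos sin subset_refl B, where c="\<lambda>_. 0" and p=0] 1 2
      by (simp add: emeasure_distr M.emeasure_eq_measure N.emeasure_eq_measure)
  qed
  show "range (\<lambda>_::nat. Pi\<^sub>E J (\<lambda>_. UNIV)) \<subseteq> prod_algebra J (\<lambda>_. borel :: real measure)"
    using J by (auto intro!: prod_algebraI_finite)
  show "(\<Union>i::nat. Pi\<^sub>E J (\<lambda>_. UNIV)) = space (Pi\<^sub>M J (\<lambda>_. borel :: real measure))" by (simp add: space_PiM)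
  interpret D: prob_space "distr M (Pi\<^sub>M J (\<lambda>_. borel)) (\<lambda>x. \<lambda>j\<in>J. X j x)"
    by (rule M.prob_space_distr) auto
  show "emeasure (distr M (Pi\<^sub>M J (\<lambda>_. borel)) (\<lambda>x. \<lambda>j\<in>J. X j x)) (Pi\<^sub>E J (\<lambda>_. UNIV)) \<noteq> \<infinity>" by simp
qed simp_all

text \<open>A factorizing joint characteristic function means independence of \<open>U\<close> from
  the family \<open>R\<close>. Independence is expressed by sampling the two arguments from separate
  copies of \<open>M\<close>, the form to which Fubini's theorem applies.\<close>

lemma joint_law_of_char_product:
  fixes U :: "'a \<Rightarrow> real" and R :: "'i \<Rightarrow> 'a \<Rightarrow> real"
  assumes M: "prob_space M" and J: "finite J"
    and U[measurable]: "U \<in> borel_measurable M" and R[measurable]: "\<And>j. j \<in> J \<Longrightarrow> R j \<in> borel_measurable M"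
    and eq: "\<And>u c. (\<integral>x. iexp (u * U x + (\<Sum>j\<in>J. c j * R j x)) \<partial>M)
        = (\<integral>x. iexp (u * U x) \<partial>M) * (\<integral>x. iexp (\<Sum>j\<in>J. c j * R j x) \<partial>M)"
  shows "distr M (borel \<Otimes>\<^sub>M Pi\<^sub>M J (\<lambda>_. borel)) (\<lambda>x. (U x, \<lambda>j\<in>J. R j x))
       = distr (M \<Otimes>\<^sub>M M) (borel \<Otimes>\<^sub>M Pi\<^sub>M J (\<lambda>_. borel)) (\<lambda>(x, y). (U x, \<lambda>j\<in>J. R j y))"
proof -
  interpret M: prob_space M by fact
  interpret P: pair_prob_space M M ..
  \<comment> \<open>One extra index for \<open>U\<close> turns the pair into a single finite family,
    to which \<open>cramer_wold\<close> applies.\<close>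
  define K where "K = insert None (Some ` J)"
  have K: "finite K" using J by (simp add: K_def)
  define X where "X k = (case k of None \<Rightarrow> U | Some j \<Rightarrow> R j)" for k
  define Y where "Y k = (case k of None \<Rightarrow> (\<lambda>z. U (fst z)) | Some j \<Rightarrow> (\<lambda>z. R j (snd z)))" for k
  have X[measurable]: "X k \<in> borel_measurable M" and Y[measurable]: "Y k \<in> borel_measurable (M \<Otimes>\<^sub>M M)" if "k \<in> K" for k
    using that unfolding K_def X_def Y_def by auto
  have sum: "(\<Sum>k\<in>K. c k * f k) = c None * f None + (\<Sum>j\<in>J. c (Some j) * f (Some j))" for c f :: "'i option \<Rightarrow> real"
    unfolding K_def using J by (simp add: sum.reindex)
  have "distr M (Pi\<^sub>M K (\<lambda>_. borel)) (\<lambda>x. \<lambda>k\<in>K. X k x) = distr (M \<Otimes>\<^sub>M M) (Pi\<^sub>M K (\<lambda>_. borel)) (\<lambda>x. \<lambda>k\<in>K. Y k x)"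
  proof (rule cramer_wold[OF M P.prob_space_axioms K X Y])
    fix c :: "'i option \<Rightarrow> real"
    let ?f = "\<lambda>x. iexp (c None * U x)" and ?g = "\<lambda>x. iexp (\<Sum>j\<in>J. c (Some j) * R j x)"
    have f: "integrable M ?f" and g: "integrable M ?g"
      by (rule M.integrable_const_bound[where B=1]; auto)+
    have fg: "integrable (M \<Otimes>\<^sub>M M) (\<lambda>(x, y). ?f x * ?g y)"
      by (rule P.integrable_const_bound[where B=1]) (auto simp: norm_mult)
    have "(\<integral>x. iexp (\<Sum>k\<in>K. c k * Y k x) \<partial>(M \<Otimes>\<^sub>M M)) = (\<integral>(x, y). ?f x * ?g y \<partial>(M \<Otimes>\<^sub>M M))"
      unfolding sum by (intro Bochner_Integration.integral_cong) (auto simp: Y_def exp_add distrib_left)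
    also have "\<dots> = (\<integral>x. (\<integral>y. ?f x * ?g y \<partial>M) \<partial>M)"
      using P.integral_fst[OF fg] by simp
    also have "\<dots> = (\<integral>x. ?f x \<partial>M) * (\<integral>y. ?g y \<partial>M)" by simp
    also have "\<dots> = (\<integral>x. iexp (\<Sum>k\<in>K. c k * X k x) \<partial>M)"
      unfolding sum eq[symmetric] by (simp add: X_def)
    finally show "(\<integral>x. iexp (\<Sum>k\<in>K. c k * X k x) \<partial>M) = (\<integral>x. iexp (\<Sum>k\<in>K. c k * Y k x) \<partial>(M \<Otimes>\<^sub>M M))" ..
  qed
  then have *: "distr (distr M (Pi\<^sub>M K (\<lambda>_. borel)) (\<lambda>x. \<lambda>k\<in>K. X k x)) (borel \<Otimes>\<^sub>M Pi\<^sub>M J (\<lambda>_. borel)) (\<lambda>z. (z None, \<lambda>j\<in>J. z (Some j)))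
    = distr (distr (M \<Otimes>\<^sub>M M) (Pi\<^sub>M K (\<lambda>_. borel)) (\<lambda>x. \<lambda>k\<in>K. Y k x)) (borel \<Otimes>\<^sub>M Pi\<^sub>M J (\<lambda>_. borel)) (\<lambda>z. (z None, \<lambda>j\<in>J. z (Some j)))"
    by simp
  have m: "(\<lambda>z. (z None, \<lambda>j\<in>J. z (Some j))) \<in> (Pi\<^sub>M K (\<lambda>_. borel)) \<rightarrow>\<^sub>M (borel \<Otimes>\<^sub>M Pi\<^sub>M J (\<lambda>_. borel :: real measure))"
    by (intro measurable_Pair measurable_restrict measurable_component_singleton) (auto simp: K_def)
  have "distr M (borel \<Otimes>\<^sub>M Pi\<^sub>M J (\<lambda>_. borel)) ((\<lambda>z. (z None, \<lambda>j\<in>J. z (Some j))) \<circ> (\<lambda>x. \<lambda>k\<in>K. X k x))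
    = distr (M \<Otimes>\<^sub>M M) (borel \<Otimes>\<^sub>M Pi\<^sub>M J (\<lambda>_. borel)) ((\<lambda>z. (z None, \<lambda>j\<in>J. z (Some j))) \<circ> (\<lambda>x. \<lambda>k\<in>K. Y k x))"
    using * by (simp add: distr_distr m)
  moreover have "((\<lambda>z. (z None, \<lambda>j\<in>J. z (Some j))) \<circ> (\<lambda>x. \<lambda>k\<in>K. X k x)) = (\<lambda>x. (U x, \<lambda>j\<in>J. R j x))"
    by (auto simp: fun_eq_iff X_def K_def)
  moreover have "((\<lambda>z. (z None, \<lambda>j\<in>J. z (Some j))) \<circ> (\<lambda>x. \<lambda>k\<in>K. Y k x)) = (\<lambda>(x, y). (U x, \<lambda>j\<in>J. R j y))"
    by (auto simp: fun_eq_iff Y_def K_def)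
  ultimately show ?thesis by simp
qed

section \<open>Centered normal variables and Stein's lemma\<close>

definition centered_normal_law :: "real \<Rightarrow> real measure" where
  "centered_normal_law \<sigma> = distr std_normal_distribution borel (\<lambda>x. \<sigma> * x)"

text \<open>The parameter \<open>\<sigma>\<close> may be zero, which gives the point mass at 0; its sign is irrelevant.\<close>

definition centered_normal :: "'a measure \<Rightarrow> ('a \<Rightarrow> real) \<Rightarrow> bool" where
  "centered_normal M f \<longleftrightarrow> f \<in> borel_measurable M \<and> (\<exists>\<sigma>. distr M borel f = centered_normal_law \<sigma>)"

lemma real_distribution_centered_normal_law: "real_distribution (centered_normal_law \<sigma>)"
proof -
  interpret real_distribution std_normal_distribution by (rule real_dist_normal_dist)
  show ?thesis unfolding centered_normal_law_def by (rule real_distribution_distr) simp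
qed

lemma char_centered_normal_law: "char (centered_normal_law \<sigma>) t = complex_of_real (exp (- ((\<sigma> * t)\<^sup>2) / 2))"
proof -
  have "char (centered_normal_law \<sigma>) t = char std_normal_distribution (\<sigma> * t)"
    unfolding char_def centered_normal_law_def by (subst integral_distr) (simp_all add: mult_ac)
  then show ?thesis by (simp add: char_std_normal_distribution)
qed

lemma centered_normalD:
  assumes "centered_normal M f"
  shows "f \<in> borel_measurable M"
  using assms by (simp add: centered_normal_def)

lemma integrable_std_normal_exp: "integrable std_normal_distribution (\<lambda>x. exp (c * x))"
proof -
  \<comment> \<open>Completing the square: the factor \<open>exp (c * x)\<close> shifts the mean to
    \<open>c\<close>.\<close>
  have "std_normal_density x * exp (c * x) = exp (c\<^sup>2 / 2) * normal_density c 1 x" for x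
    by (simp add: normal_density_def exp_add[symmetric] power2_eq_square field_simps)
  then have "integrable lborel (\<lambda>x. std_normal_density x * exp (c * x))" by simp
  then show ?thesis by (subst integrable_density) auto
qed

lemma integrable_std_normal_exp_abs: "integrable std_normal_distribution (\<lambda>x. exp (c * \<bar>x\<bar>))"
proof (rule Bochner_Integration.integrable_bound)
  show "integrable std_normal_distribution (\<lambda>x. exp (c * x) + exp ((- c) * x))"
    using integrable_std_normal_exp[of c] integrable_std_normal_exp[of "-c"] by (rule Bochner_Integration.integrable_add)
  have "exp (c * \<bar>x\<bar>) \<le> \<bar>exp (c * x) + exp ((- c) * x)\<bar>" for x :: real
    using exp_gt_zero[of "c * x"] exp_gt_zero[of "- c * x"] by (cases "0 \<le> x") auto
  then show "AE x in std_normal_distribution. norm (exp (c * \<bar>x\<bar>)) \<le> norm (exp (c * x) + exp ((- c) * x))"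
    by (intro AE_I2) simp
qed simp

lemma centered_normal_integral:
  assumes f: "f \<in> borel_measurable M" "distr M borel f = centered_normal_law \<sigma>" and g: "g \<in> borel_measurable borel"
  shows "(\<integral>x. g (f x) \<partial>M) = (\<integral>x. (g (\<sigma> * x) :: 'b :: {banach, second_countable_topology}) \<partial>std_normal_distribution)"
    and "integrable M (\<lambda>x. g (f x)) \<longleftrightarrow> integrable std_normal_distribution (\<lambda>x. g (\<sigma> * x))"
  using arg_cong[OF f(2), of "\<lambda>m. integral\<^sup>L m g"] arg_cong[OF f(2), of "\<lambda>m. integrable m g"] f(1) g
  by (simp_all add: centered_normal_law_def integral_distr integrable_distr_eq)

text \<open>These are the dominating functions for the smooth maxima and their derivatives, hence
  the free constant \<open>c\<close>.\<close>

lemma centered_normal_exp_abs: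
  assumes "centered_normal M f"
  shows "integrable M (\<lambda>x. exp (c * \<bar>f x\<bar>))"
proof -
  obtain \<sigma> where s: "f \<in> borel_measurable M" "distr M borel f = centered_normal_law \<sigma>"
    using assms by (auto simp: centered_normal_def)
  show ?thesis
    using centered_normal_integral(2)[OF s, of "\<lambda>x. exp (c * \<bar>x\<bar>)"] integrable_std_normal_exp_abs[of "c * \<bar>\<sigma>\<bar>"]
    by (simp add: abs_mult mult_ac)
qed

lemma std_normal_moments:
  "(\<integral>x. x \<partial>std_normal_distribution) = 0" "(\<integral>x. x\<^sup>2 \<partial>std_normal_distribution) = 1"
  "integrable std_normal_distribution (\<lambda>x. x)" "integrable std_normal_distribution (\<lambda>x. x\<^sup>2)"
  using integral_std_normal_distribution_moment_odd[of 1] std_normal_distribution_even_moments[of 1]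
    integrable_std_normal_distribution_moment[of 1] integrable_std_normal_distribution_moment[of 2] by simp_all

lemma centered_normal_moments:
  assumes "f \<in> borel_measurable M" "distr M borel f = centered_normal_law \<sigma>"
  shows "integrable M f" "(\<integral>x. f x \<partial>M) = 0" "integrable M (\<lambda>x. (f x)\<^sup>2)" "(\<integral>x. (f x)\<^sup>2 \<partial>M) = \<sigma>\<^sup>2"
proof -
  have 1: "integrable M f \<longleftrightarrow> integrable std_normal_distribution (\<lambda>x. \<sigma> * x)" and 2: "(\<integral>x. f x \<partial>M) = (\<integral>x. \<sigma> * x \<partial>std_normal_distribution)"
    by (rule centered_normal_integral[OF assms, of "\<lambda>x. x"]; simp)+
  have 3: "integrable M (\<lambda>x. (f x)\<^sup>2) \<longleftrightarrow> integrable std_normal_distribution (\<lambda>x. (\<sigma> * x)\<^sup>2)"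
    and 4: "(\<integral>x. (f x)\<^sup>2 \<partial>M) = (\<integral>x. (\<sigma> * x)\<^sup>2 \<partial>std_normal_distribution)"
    by (rule centered_normal_integral[OF assms, of "\<lambda>x. x\<^sup>2"]; simp)+
  show "integrable M f" unfolding 1 by (rule integrable_mult_right) (rule std_normal_moments)
  show "(\<integral>x. f x \<partial>M) = 0" unfolding 2 by (simp only: integral_mult_right_zero std_normal_moments mult_zero_right)
  show "integrable M (\<lambda>x. (f x)\<^sup>2)" unfolding 3 power_mult_distrib by (rule integrable_mult_right) (rule std_normal_moments)
  show "(\<integral>x. (f x)\<^sup>2 \<partial>M) = \<sigma>\<^sup>2" unfolding 4 power_mult_distrib
    by (simp only: integral_mult_right_zero std_normal_moments mult_1_right)
qed

text \<open>Uses the second moment instead of the parameter \<sigma>: second moments of linear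
  combinations can be expanded, and their additivity then becomes factorization of characteristic
  functions.\<close>

lemma centered_normal_iexp:
  assumes "centered_normal M f"
  shows "(\<integral>x. iexp (t * f x) \<partial>M) = complex_of_real (exp (- (t\<^sup>2 * (\<integral>x. (f x)\<^sup>2 \<partial>M)) / 2))"
proof -
  obtain \<sigma> where s: "f \<in> borel_measurable M" "distr M borel f = centered_normal_law \<sigma>"
    using assms by (auto simp: centered_normal_def)
  show ?thesis
    using char_centered_normal_law[of \<sigma> t] unfolding s(2)[symmetric] centered_normal_moments(4)[OF s]
    using s(1) by (simp add: char_def integral_distr power_mult_distrib mult_ac)
qed

lemma centered_normalI:
  assumes M: "prob_space M" and f: "f \<in> borel_measurable M"
    and "\<And>t. (\<integral>x. iexp (t * f x) \<partial>M) = complex_of_real (exp (- ((\<sigma> * t)\<^sup>2) / 2))"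
  shows "centered_normal M f"
proof -
  interpret prob_space M by fact
  have "distr M borel f = centered_normal_law \<sigma>"
    using assms by (intro Levy_uniqueness real_distribution_centered_normal_law real_distribution_distr)
      (simp_all add: fun_eq_iff char_centered_normal_law, simp add: char_def integral_distr)
  then show ?thesis using f by (auto simp: centered_normal_def)
qed

text \<open>The sum \<open>a + b\<close> is at most twice its larger summand. This takes the place
  of Hoelder's inequality: exponential moments of a sum follow from those of the summands, whatever
  their dependence, at the price of doubled exponents.\<close>

lemma exp_add_le: "exp (a + b) \<le> exp (2 * a) + exp (2 * b)" for a b :: real
proof (cases "a \<le> b")
  case True
  then have "exp (a + b) \<le> exp (2 * b)" by simp
  then show ?thesis using exp_gt_zero[of "2 * a"] by linarith
next
  case False
  then have "exp (a + b) \<le> exp (2 * a)" by simp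
  then show ?thesis using exp_gt_zero[of "2 * b"] by linarith
qed

text \<open>Each split of the sum doubles the exponent, which is why the hypothesis ranges over all
  \<open>c\<close> and the induction keeps \<open>c\<close> general.\<close>

lemma integrable_exp_sum_abs:
  fixes f :: "'i \<Rightarrow> 'a \<Rightarrow> real"
  assumes "finite I" and "prob_space M" and "\<And>i. i \<in> I \<Longrightarrow> f i \<in> borel_measurable M"
    and "\<And>i c. i \<in> I \<Longrightarrow> integrable M (\<lambda>x. exp (c * \<bar>f i x\<bar>))"
  shows "integrable M (\<lambda>x. exp (c * (\<Sum>i\<in>I. \<bar>f i x\<bar>)))"
  using assms(1,3,4)
proof (induction I arbitrary: c)
  case empty
  interpret prob_space M by fact
  show ?case by simp
next
  case (insert i I)
  show ?case
  proof (rule Bochner_Integration.integrable_bound)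
    show "integrable M (\<lambda>x. exp (2 * c * \<bar>f i x\<bar>) + exp (2 * c * (\<Sum>i\<in>I. \<bar>f i x\<bar>)))"
      using insert by (intro Bochner_Integration.integrable_add) auto
    show "AE x in M. norm (exp (c * (\<Sum>i\<in>insert i I. \<bar>f i x\<bar>))) \<le> norm (exp (2 * c * \<bar>f i x\<bar>) + exp (2 * c * (\<Sum>i\<in>I. \<bar>f i x\<bar>)))"
    proof (intro AE_I2)
      fix x
      show "norm (exp (c * (\<Sum>i\<in>insert i I. \<bar>f i x\<bar>))) \<le> norm (exp (2 * c * \<bar>f i x\<bar>) + exp (2 * c * (\<Sum>i\<in>I. \<bar>f i x\<bar>)))"
        using insert(1,2) exp_add_le[of "c * \<bar>f i x\<bar>" "c * (\<Sum>i\<in>I. \<bar>f i x\<bar>)"]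
        by (simp add: distrib_left abs_of_pos add_pos_pos mult.assoc)
    qed
    have "\<And>j. j \<in> insert i I \<Longrightarrow> f j \<in> borel_measurable M" using insert.prems(1) .
    then     show "(\<lambda>x. exp (c * (\<Sum>i\<in>insert i I. \<bar>f i x\<bar>))) \<in> borel_measurable M"
      by (intro measurable_compose[OF _ borel_measurable_exp] borel_measurable_times borel_measurable_const borel_measurable_sum borel_measurable_abs)
  qed
qed

text \<open>The density \<phi> satisfies \<open>\<phi>' x = - x * \<phi> x\<close>, so
  \<open>\<phi> x * (x * g x - g' x)\<close> is the derivative of \<open>- (\<phi> x * g x)\<close>.
  Its integral over the line is a difference of boundary values, and these vanish because
  \<open>g\<close> grows at most exponentially.\<close>

lemma std_normal_stein:
  fixes g g' :: "real \<Rightarrow> real"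
  assumes g: "\<And>x. (g has_real_derivative g' x) (at x)" and g': "continuous_on UNIV g'"
    and b: "\<And>x. \<bar>g x\<bar> \<le> K * exp (k * \<bar>x\<bar>)" and b': "\<And>x. \<bar>g' x\<bar> \<le> K * exp (k * \<bar>x\<bar>)"
  shows "(\<integral>x. x * g x \<partial>std_normal_distribution) = (\<integral>x. g' x \<partial>std_normal_distribution)"
proof -
  have gc: "continuous_on UNIV g" using g by (meson DERIV_isCont continuous_at_imp_continuous_on)
  have [measurable]: "g \<in> borel_measurable borel" "g' \<in> borel_measurable borel"
    using gc g' by (auto intro: borel_measurable_continuous_onI)
  have i1: "integrable std_normal_distribution g'"
  proof (rule Bochner_Integration.integrable_bound)
    show "integrable std_normal_distribution (\<lambda>x. K * exp (k * \<bar>x\<bar>))" using integrable_std_normal_exp_abs by simp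
    show "AE x in std_normal_distribution. norm (g' x) \<le> norm (K * exp (k * \<bar>x\<bar>))"
      using b' order_trans[OF b' abs_ge_self] by (intro AE_I2) simp
  qed simp
  have i2: "integrable std_normal_distribution (\<lambda>x. x * g x)"
  proof (rule Bochner_Integration.integrable_bound)
    show "integrable std_normal_distribution (\<lambda>x. K * exp ((k + 1) * \<bar>x\<bar>))" using integrable_std_normal_exp_abs by simp
    have "\<bar>x * g x\<bar> \<le> K * exp ((k + 1) * \<bar>x\<bar>)" for x
    proof -
      have "\<bar>x\<bar> \<le> exp \<bar>x\<bar>" using exp_ge_add_one_self[of "\<bar>x\<bar>"] by linarith
      then have "\<bar>x\<bar> * \<bar>g x\<bar> \<le> exp \<bar>x\<bar> * (K * exp (k * \<bar>x\<bar>))" using b by (intro mult_mono) auto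
      then show ?thesis by (simp add: abs_mult exp_add[symmetric] algebra_simps)
    qed
    then show "AE x in std_normal_distribution. norm (x * g x) \<le> norm (K * exp ((k + 1) * \<bar>x\<bar>))"
      unfolding real_norm_def by (intro AE_I2) (rule order_trans[OF _ abs_ge_self])
  qed simp
  let ?F = "\<lambda>x. - (std_normal_density x * g x)"
  let ?f = "\<lambda>x. std_normal_density x * (x * g x - g' x)"
  have id: "integrable lborel ?f"
    using Bochner_Integration.integrable_diff[OF i2 i1] by (subst (asm) integrable_density) auto
  have dn: "(std_normal_density has_real_derivative - x * std_normal_density x) (at x)" for x
    unfolding std_normal_density_def by (auto intro!: derivative_eq_intros simp: field_simps)
  have bd: "norm (?F x) \<le> K * exp (k * \<bar>x\<bar> - x\<^sup>2 / 2)" for x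
  proof -
    have "std_normal_density x \<le> exp (- x\<^sup>2 / 2)"
    proof -
      have "1 \<le> sqrt (2 * pi)" using pi_ge_two by simp
      then have "1 / sqrt (2 * pi) \<le> 1" by simp
      then show ?thesis unfolding std_normal_density_def by (intro mult_left_le_one_le) auto
    qed
    then have "std_normal_density x * \<bar>g x\<bar> \<le> exp (- x\<^sup>2 / 2) * (K * exp (k * \<bar>x\<bar>))"
      using b by (intro mult_mono) auto
    moreover have "exp (k * \<bar>x\<bar> - x\<^sup>2 / 2) = exp (- x\<^sup>2 / 2) * exp (k * \<bar>x\<bar>)" by (simp add: exp_add[symmetric])
    ultimately show ?thesis by (simp add: abs_mult mult_ac)
  qed
  have "(LBINT x=-\<infinity>..\<infinity>. ?f x) = 0 - 0"
  proof (rule interval_integral_FTC_integrable)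
    show "(?F has_vector_derivative ?f x) (at x)" for x
      unfolding has_real_derivative_iff_has_vector_derivative[symmetric]
      by (auto intro!: derivative_eq_intros dn g simp: algebra_simps)
    have "continuous_on UNIV ?f"
      unfolding std_normal_density_def by (intro continuous_intros gc g') simp_all
    then show "isCont ?f x" for x by (simp add: continuous_on_eq_continuous_at)
    show "set_integrable lborel (einterval (- \<infinity>) \<infinity>) ?f"
      using id by (simp add: set_integrable_def einterval_def)
    have *: "((\<lambda>x. K * exp (k * x - x\<^sup>2 / 2)) \<longlongrightarrow> 0) at_top" by real_asymp
    have top: "((\<lambda>x. K * exp (k * \<bar>x\<bar> - x\<^sup>2 / 2)) \<longlongrightarrow> 0) at_top"
      by (rule Lim_transform_eventually[OF *]) (auto simp: eventually_at_top_linorder intro!: exI[of _ 0])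
    have bot: "((\<lambda>x. K * exp (k * \<bar>x\<bar> - x\<^sup>2 / 2)) \<longlongrightarrow> 0) at_bot"
      using top by (subst at_bot_mirror) (simp add: filterlim_filtermap)
    show "((?F \<circ> real_of_ereal) \<longlongrightarrow> 0) (at_right (- \<infinity>))"
      unfolding ereal_tendsto_simps by (rule Lim_null_comparison[OF _ bot]) (use bd in auto)
    show "((?F \<circ> real_of_ereal) \<longlongrightarrow> 0) (at_left \<infinity>)"
      unfolding ereal_tendsto_simps by (rule Lim_null_comparison[OF _ top]) (use bd in auto)
  qed simp
  then have "(\<integral>x. ?f x \<partial>lborel) = 0" by (simp add: interval_lebesgue_integral_def set_lebesgue_integral_def einterval_def)
  then have "(\<integral>x. x * g x - g' x \<partial>std_normal_distribution) = 0" by (subst integral_density) auto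
  then show ?thesis using i1 i2 by simp
qed

lemma centered_normal_stein:
  assumes f: "f \<in> borel_measurable M" "distr M borel f = centered_normal_law \<sigma>"
    and g: "\<And>x. (g has_real_derivative g' x) (at x)" and g': "continuous_on UNIV g'"
    and b: "\<And>x. \<bar>g x\<bar> \<le> K * exp (k * \<bar>x\<bar>)" and b': "\<And>x. \<bar>g' x\<bar> \<le> K * exp (k * \<bar>x\<bar>)"
  shows "(\<integral>x. f x * g (f x) \<partial>M) = \<sigma>\<^sup>2 * (\<integral>x. g' (f x) \<partial>M)"
proof -
  have gc: "continuous_on UNIV g" using g by (meson DERIV_isCont continuous_at_imp_continuous_on)
  have [measurable]: "g \<in> borel_measurable borel" "g' \<in> borel_measurable borel"
    using gc g' by (auto intro: borel_measurable_continuous_onI)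
  have K0: "K \<ge> 0" using b[of 0] by simp
  have "(\<integral>x. f x * g (f x) \<partial>M) = \<sigma> * (\<integral>x. x * g (\<sigma> * x) \<partial>std_normal_distribution)"
    using centered_normal_integral(1)[OF f, of "\<lambda>x. x * g x"] by (simp add: mult.assoc)
  also have "(\<integral>x. x * g (\<sigma> * x) \<partial>std_normal_distribution) = (\<integral>x. \<sigma> * g' (\<sigma> * x) \<partial>std_normal_distribution)"
  proof (rule std_normal_stein)
    show "((\<lambda>x. g (\<sigma> * x)) has_real_derivative \<sigma> * g' (\<sigma> * x)) (at x)" for x
      using DERIV_chain2[OF g DERIV_cmult_Id, of \<sigma> x UNIV] by (simp add: mult.commute)
    show "continuous_on UNIV (\<lambda>x. \<sigma> * g' (\<sigma> * x))"
      by (intro continuous_intros continuous_on_compose2[OF g']) auto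
    \<comment> \<open>One constant has to serve both \<open>g (\<sigma> * x)\<close> and
      \<open>\<sigma> * g' (\<sigma> * x)\<close>, whence the maximum with 1.\<close>
    have l: "K * exp (k * \<bar>\<sigma> * x\<bar>) \<le> (max 1 \<bar>\<sigma>\<bar> * K) * exp ((k * \<bar>\<sigma>\<bar>) * \<bar>x\<bar>)" for x
      using K0 by (simp add: abs_mult mult.assoc mult_right_mono[of 1 "max 1 \<bar>\<sigma>\<bar>", simplified])
    show "\<bar>g (\<sigma> * x)\<bar> \<le> (max 1 \<bar>\<sigma>\<bar> * K) * exp ((k * \<bar>\<sigma>\<bar>) * \<bar>x\<bar>)" for x
      using b[of "\<sigma> * x"] l[of x] by linarith
    have "\<bar>\<sigma> * g' (\<sigma> * x)\<bar> \<le> max 1 \<bar>\<sigma>\<bar> * (K * exp (k * \<bar>\<sigma> * x\<bar>))" for x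
      using b'[of "\<sigma> * x"] by (auto simp: abs_mult intro!: mult_mono)
    then show "\<bar>\<sigma> * g' (\<sigma> * x)\<bar> \<le> (max 1 \<bar>\<sigma>\<bar> * K) * exp ((k * \<bar>\<sigma>\<bar>) * \<bar>x\<bar>)" for x
      by (simp add: abs_mult mult.assoc)
  qed
  also have "\<sigma> * (\<integral>x. \<sigma> * g' (\<sigma> * x) \<partial>std_normal_distribution) = \<sigma>\<^sup>2 * (\<integral>x. g' (f x) \<partial>M)"
    using centered_normal_integral(1)[OF f, of g'] by (simp add: power2_eq_square)
  finally show ?thesis .
qed

section \<open>Integration by parts for Gaussian vectors\<close>

lemma integrable_mult_of_squares:
  fixes f g :: "'a \<Rightarrow> real"
  assumes [measurable]: "f \<in> borel_measurable M" "g \<in> borel_measurable M"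
    and "integrable M (\<lambda>x. (f x)\<^sup>2)" "integrable M (\<lambda>x. (g x)\<^sup>2)"
  shows "integrable M (\<lambda>x. f x * g x)"
proof (rule Bochner_Integration.integrable_bound)
  show "integrable M (\<lambda>x. (f x)\<^sup>2 + (g x)\<^sup>2)" using assms by simp
  have "\<bar>a * b\<bar> \<le> a\<^sup>2 + b\<^sup>2" for a b :: real
  proof -
    have "2 * \<bar>a * b\<bar> \<le> a\<^sup>2 + b\<^sup>2" using sum_squares_bound[of "\<bar>a\<bar>" "\<bar>b\<bar>"] by (simp add: abs_mult mult.assoc)
    then show ?thesis by simp
  qed
  then show "AE x in M. norm (f x * g x) \<le> norm ((f x)\<^sup>2 + (g x)\<^sup>2)" by (intro AE_I2) simp
qed simp

lemma centered_normal_integrable: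
  assumes "centered_normal M f"
  shows "integrable M f" "(\<integral>x. f x \<partial>M) = 0" "integrable M (\<lambda>x. (f x)\<^sup>2)"
  using assms centered_normal_moments by (auto simp: centered_normal_def)

text \<open>By \<open>law\<close> the expectations may be computed with \<open>R\<close> drawn
  independently of \<open>U\<close>; the inner integral over \<open>U\<close> is then the
  one-dimensional identity with a frozen second argument. The growth constants may depend on
  \<open>r\<close> because they serve this inner integral, joint integrability being assumed
  separately.\<close>

lemma stein_conditional:
  fixes U :: "'a \<Rightarrow> real" and R :: "'i \<Rightarrow> 'a \<Rightarrow> real" and \<Phi> \<Psi> :: "real \<times> ('i \<Rightarrow> real) \<Rightarrow> real"
  assumes M: "prob_space M" and J: "finite J"
    and U: "U \<in> borel_measurable M" "distr M borel U = centered_normal_law \<sigma>"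
    and R[measurable]: "\<And>j. j \<in> J \<Longrightarrow> R j \<in> borel_measurable M"
    and law: "distr M (borel \<Otimes>\<^sub>M Pi\<^sub>M J (\<lambda>_. borel)) (\<lambda>x. (U x, \<lambda>j\<in>J. R j x))
       = distr (M \<Otimes>\<^sub>M M) (borel \<Otimes>\<^sub>M Pi\<^sub>M J (\<lambda>_. borel)) (\<lambda>(x, y). (U x, \<lambda>j\<in>J. R j y))"
    and m[measurable]: "\<Phi> \<in> borel_measurable (borel \<Otimes>\<^sub>M Pi\<^sub>M J (\<lambda>_. borel))" "\<Psi> \<in> borel_measurable (borel \<Otimes>\<^sub>M Pi\<^sub>M J (\<lambda>_. borel))"
    and int: "integrable M (\<lambda>x. U x * \<Phi> (U x, \<lambda>j\<in>J. R j x))" "integrable M (\<lambda>x. \<Psi> (U x, \<lambda>j\<in>J. R j x))"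
    and d: "\<And>u r. ((\<lambda>u. \<Phi> (u, r)) has_real_derivative \<Psi> (u, r)) (at u)" "\<And>r. continuous_on UNIV (\<lambda>u. \<Psi> (u, r))"
    and b: "\<And>r. \<exists>K k. \<forall>u. \<bar>\<Phi> (u, r)\<bar> \<le> K * exp (k * \<bar>u\<bar>) \<and> \<bar>\<Psi> (u, r)\<bar> \<le> K * exp (k * \<bar>u\<bar>)"
  shows "(\<integral>x. U x * \<Phi> (U x, \<lambda>j\<in>J. R j x) \<partial>M) = \<sigma>\<^sup>2 * (\<integral>x. \<Psi> (U x, \<lambda>j\<in>J. R j x) \<partial>M)"
proof -
  interpret M: prob_space M by fact
  interpret P: pair_prob_space M M ..
  note [measurable] = U(1)
  have [measurable]: "(\<lambda>x. \<lambda>j\<in>J. R j x) \<in> M \<rightarrow>\<^sub>M Pi\<^sub>M J (\<lambda>_. borel)"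
    by (intro measurable_restrict) simp
  have tr: "(\<integral>x. F (U x, \<lambda>j\<in>J. R j x) \<partial>M) = (\<integral>y. (\<integral>x. F (U x, \<lambda>j\<in>J. R j y) \<partial>M) \<partial>M)"
    if [measurable]: "F \<in> borel_measurable (borel \<Otimes>\<^sub>M Pi\<^sub>M J (\<lambda>_. borel))" and i: "integrable M (\<lambda>x. F (U x, \<lambda>j\<in>J. R j x))"
    for F :: "real \<times> ('i \<Rightarrow> real) \<Rightarrow> real"
  proof -
    have "integrable (distr M (borel \<Otimes>\<^sub>M Pi\<^sub>M J (\<lambda>_. borel)) (\<lambda>x. (U x, \<lambda>j\<in>J. R j x))) F"
      using i by (subst integrable_distr_eq) auto
    then have i2: "integrable (M \<Otimes>\<^sub>M M) (\<lambda>(x, y). F (U x, \<lambda>j\<in>J. R j y))"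
      unfolding law by (subst (asm) integrable_distr_eq) (auto simp: split_beta')
    have "(\<integral>x. F (U x, \<lambda>j\<in>J. R j x) \<partial>M) = (\<integral>z. F z \<partial>distr M (borel \<Otimes>\<^sub>M Pi\<^sub>M J (\<lambda>_. borel)) (\<lambda>x. (U x, \<lambda>j\<in>J. R j x)))"
      by (subst integral_distr) auto
    also have "\<dots> = (\<integral>(x, y). F (U x, \<lambda>j\<in>J. R j y) \<partial>(M \<Otimes>\<^sub>M M))"
      unfolding law by (subst integral_distr) (auto simp: split_beta')
    also have "\<dots> = (\<integral>y. (\<integral>x. F (U x, \<lambda>j\<in>J. R j y) \<partial>M) \<partial>M)"
      using P.integral_snd[OF i2] by simp
    finally show ?thesis .
  qed
  have "(\<integral>x. U x * \<Phi> (U x, \<lambda>j\<in>J. R j x) \<partial>M) = (\<integral>y. (\<integral>x. U x * \<Phi> (U x, \<lambda>j\<in>J. R j y) \<partial>M) \<partial>M)"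
    using tr[of "\<lambda>z. fst z * \<Phi> z"] int by simp
  also have "\<dots> = (\<integral>y. \<sigma>\<^sup>2 * (\<integral>x. \<Psi> (U x, \<lambda>j\<in>J. R j y) \<partial>M) \<partial>M)"
  proof (intro Bochner_Integration.integral_cong refl)
    fix y
    obtain K k where "\<forall>u. \<bar>\<Phi> (u, \<lambda>j\<in>J. R j y)\<bar> \<le> K * exp (k * \<bar>u\<bar>) \<and> \<bar>\<Psi> (u, \<lambda>j\<in>J. R j y)\<bar> \<le> K * exp (k * \<bar>u\<bar>)"
      using b by blast
    then show "(\<integral>x. U x * \<Phi> (U x, \<lambda>j\<in>J. R j y) \<partial>M) = \<sigma>\<^sup>2 * (\<integral>x. \<Psi> (U x, \<lambda>j\<in>J. R j y) \<partial>M)"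
      by (intro centered_normal_stein[OF U d(1) d(2)]) auto
  qed
  also have "\<dots> = \<sigma>\<^sup>2 * (\<integral>x. \<Psi> (U x, \<lambda>j\<in>J. R j x) \<partial>M)"
    using tr[of \<Psi>] int by simp
  finally show ?thesis .
qed

text \<open>
  Gaussian integration by parts. The residuals \<open>R\<^sub>j = Z\<^sub>j - (E U Z\<^sub>j / E U\<^sup>2) U\<close> are uncorrelated with
  \<open>U\<close>, hence independent of it, so that the one-dimensional identity applies with \<open>R\<close> frozen.
\<close>

lemma stein_gaussian_vector:
  fixes U :: "'a \<Rightarrow> real" and Z :: "'i \<Rightarrow> 'a \<Rightarrow> real" and G :: "('i \<Rightarrow> real) \<Rightarrow> real" and dG :: "'i \<Rightarrow> ('i \<Rightarrow> real) \<Rightarrow> real"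
  assumes M: "prob_space M" and J: "finite J"
    and cn: "\<And>u c. centered_normal M (\<lambda>x. u * U x + (\<Sum>j\<in>J. c j * Z j x))"
    and G_meas: "G \<in> borel_measurable (Pi\<^sub>M J (\<lambda>_. borel))"
    and dG_meas: "\<And>j. j \<in> J \<Longrightarrow> dG j \<in> borel_measurable (Pi\<^sub>M J (\<lambda>_. borel))"
    and G_restrict: "\<And>z. G (restrict z J) = G z" and dG_restrict: "\<And>j z. j \<in> J \<Longrightarrow> dG j (restrict z J) = dG j z"
    and deriv: "\<And>z w s. ((\<lambda>s. G (\<lambda>j. z j + s * w j)) has_real_derivative (\<Sum>j\<in>J. w j * dG j (\<lambda>j. z j + s * w j))) (at s)"
    and cont: "\<And>z w j. j \<in> J \<Longrightarrow> continuous_on UNIV (\<lambda>s. dG j (\<lambda>j. z j + s * w j))"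
    and k: "0 \<le> k"
    and G_bound: "\<And>z. \<bar>G z\<bar> \<le> K * exp (k * (\<Sum>j\<in>J. \<bar>z j\<bar>))"
    and dG_bound: "\<And>j z. j \<in> J \<Longrightarrow> \<bar>dG j z\<bar> \<le> K * exp (k * (\<Sum>j\<in>J. \<bar>z j\<bar>))"
  shows "(\<integral>x. U x * G (\<lambda>j. Z j x) \<partial>M) = (\<Sum>j\<in>J. (\<integral>x. U x * Z j x \<partial>M) * (\<integral>x. dG j (\<lambda>j. Z j x) \<partial>M))"
proof -
  interpret M: prob_space M by fact
  have UN: "centered_normal M U" using cn[of 1 "\<lambda>_. 0"] by simp
  have ZN: "centered_normal M (Z j)" if "j \<in> J" for j
    using cn[of 0 "\<lambda>i. if i = j then 1 else 0"] that J by (simp add: if_distrib[of "\<lambda>u. u * _"] cong: if_cong)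
  have U[measurable]: "U \<in> borel_measurable M" and Z[measurable]: "\<And>j. j \<in> J \<Longrightarrow> Z j \<in> borel_measurable M"
    using UN ZN by (auto dest: centered_normalD)
  obtain \<sigma> where s: "distr M borel U = centered_normal_law \<sigma>" using UN by (auto simp: centered_normal_def)
  have v: "(\<integral>x. (U x)\<^sup>2 \<partial>M) = \<sigma>\<^sup>2" using centered_normal_moments(4)[OF U s] .
  have UZ: "integrable M (\<lambda>x. U x * Z j x)" if "j \<in> J" for j
    using that UN ZN[OF that] by (intro integrable_mult_of_squares centered_normal_integrable) auto
  show ?thesis
  proof (cases "\<sigma> = 0")
    \<comment> \<open>Regression on \<open>U\<close> would divide by zero, but here \<open>U\<close>
      vanishes almost everywhere, and with it both sides.\<close>
    case True
    then have "AE x in M. (U x)\<^sup>2 = 0"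
      using v centered_normal_integrable(3)[OF UN] by (subst integral_nonneg_eq_0_iff_AE[symmetric]) auto
    then have U0: "AE x in M. U x = 0" by simp
    have "(\<integral>x. U x * G (\<lambda>j. Z j x) \<partial>M) = 0" "(\<integral>x. U x * Z j x \<partial>M) = 0" for j
      by (intro integral_eq_zero_AE; use U0 in auto)+
    then show ?thesis by simp
  next
    case False
    define a where "a j = (\<integral>x. U x * Z j x \<partial>M) / \<sigma>\<^sup>2" for j
    define R where "R j x = Z j x - a j * U x" for j x
    have R[measurable]: "R j \<in> borel_measurable M" if "j \<in> J" for j using that unfolding R_def by measurable
    have comb: "u * U x + (\<Sum>j\<in>J. c j * R j x) = (u - (\<Sum>j\<in>J. c j * a j)) * U x + (\<Sum>j\<in>J. c j * Z j x)" for u c x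
      by (simp add: R_def algebra_simps sum_subtractf sum_distrib_left sum_distrib_right)
    have cnR: "centered_normal M (\<lambda>x. u * U x + (\<Sum>j\<in>J. c j * R j x))" for u c
      unfolding comb by (rule cn)
    have UR: "(\<integral>x. U x * R j x \<partial>M) = 0" and UR_int: "integrable M (\<lambda>x. U x * R j x)" if "j \<in> J" for j
    proof -
      have eq: "U x * R j x = U x * Z j x - a j * (U x)\<^sup>2" for x by (simp add: R_def algebra_simps power2_eq_square)
      show "(\<integral>x. U x * R j x \<partial>M) = 0" "integrable M (\<lambda>x. U x * R j x)"
        unfolding eq using UZ[OF that] centered_normal_integrable(3)[OF UN] v False by (simp_all add: a_def)
    qed
    have law: "distr M (borel \<Otimes>\<^sub>M Pi\<^sub>M J (\<lambda>_. borel)) (\<lambda>x. (U x, \<lambda>j\<in>J. R j x))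
       = distr (M \<Otimes>\<^sub>M M) (borel \<Otimes>\<^sub>M Pi\<^sub>M J (\<lambda>_. borel)) (\<lambda>(x, y). (U x, \<lambda>j\<in>J. R j y))"
    proof (rule joint_law_of_char_product[OF M J U R])
      fix u :: real and c :: "'i \<Rightarrow> real"
      define T where "T x = (\<Sum>j\<in>J. c j * R j x)" for x
      have TN: "centered_normal M T" using cnR[of 0 c] by (simp add: T_def[abs_def])
      have UTN: "centered_normal M (\<lambda>x. u * U x + T x)" using cnR[of u c] by (simp add: T_def)
      \<comment> \<open>The cross terms have mean zero by the choice of \<open>a\<close>, so second
        moments add and the characteristic function factorizes.\<close>
      have "(\<integral>x. (u * U x + T x)\<^sup>2 \<partial>M) = (\<integral>x. u\<^sup>2 * (U x)\<^sup>2 + (T x)\<^sup>2 + (\<Sum>j\<in>J. 2 * u * c j * (U x * R j x)) \<partial>M)"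
        by (intro Bochner_Integration.integral_cong refl)
           (simp add: power2_sum T_def sum_distrib_left power_mult_distrib mult_ac)
      also have "\<dots> = u\<^sup>2 * (\<integral>x. (U x)\<^sup>2 \<partial>M) + (\<integral>x. (T x)\<^sup>2 \<partial>M)"
        using UR UR_int centered_normal_integrable(3)[OF UN] centered_normal_integrable(3)[OF TN] by simp
      finally have *: "(\<integral>x. (u * U x + T x)\<^sup>2 \<partial>M) = u\<^sup>2 * (\<integral>x. (U x)\<^sup>2 \<partial>M) + (\<integral>x. (T x)\<^sup>2 \<partial>M)" .
      have "(\<integral>x. iexp (u * U x + T x) \<partial>M) = (\<integral>x. iexp (u * U x) \<partial>M) * (\<integral>x. iexp (T x) \<partial>M)"
        using centered_normal_iexp[OF UTN, of 1] centered_normal_iexp[OF UN, of u] centered_normal_iexp[OF TN, of 1] *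
        by (simp add: exp_add[symmetric] exp_of_real[symmetric] add_divide_distrib diff_divide_distrib del: of_real_add exp_of_real)
      then show "(\<integral>x. iexp (u * U x + (\<Sum>j\<in>J. c j * R j x)) \<partial>M) = (\<integral>x. iexp (u * U x) \<partial>M) * (\<integral>x. iexp (\<Sum>j\<in>J. c j * R j x) \<partial>M)"
        by (simp add: T_def)
    qed
    \<comment> \<open>Since \<open>Z j\<close> is \<open>R j\<close> plus \<open>a j\<close> times
      \<open>U\<close>, freezing \<open>R\<close> leaves a function of \<open>u\<close> along a line
      with direction \<open>a\<close>; \<Psi> is its derivative.\<close>
    define \<Phi> where "\<Phi> = (\<lambda>(u, r). G (\<lambda>j. r j + u * a j))"
    define \<Psi> where "\<Psi> = (\<lambda>(u, r). \<Sum>j\<in>J. a j * dG j (\<lambda>j. r j + u * a j))"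
    have shift[measurable]: "(\<lambda>(u, r). \<lambda>j\<in>J. r j + u * a j) \<in> borel \<Otimes>\<^sub>M Pi\<^sub>M J (\<lambda>_. borel) \<rightarrow>\<^sub>M Pi\<^sub>M J (\<lambda>_. borel)"
      unfolding split_beta' by (intro measurable_restrict) measurable
    have m: "\<Phi> \<in> borel_measurable (borel \<Otimes>\<^sub>M Pi\<^sub>M J (\<lambda>_. borel))"
      using measurable_compose[OF shift G_meas] by (simp add: \<Phi>_def split_beta' G_restrict)
    have "(\<lambda>z. dG j (\<lambda>j. snd z j + fst z * a j)) \<in> borel_measurable (borel \<Otimes>\<^sub>M Pi\<^sub>M J (\<lambda>_. borel))" if "j \<in> J" for j
      using measurable_compose[OF shift dG_meas[OF that]] that by (simp add: split_beta' dG_restrict)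
    then have m': "\<Psi> \<in> borel_measurable (borel \<Otimes>\<^sub>M Pi\<^sub>M J (\<lambda>_. borel))"
      unfolding \<Psi>_def split_beta' by (intro borel_measurable_sum borel_measurable_times) auto
    \<comment> \<open>Off \<open>J\<close> the restriction supplies \<open>undefined\<close>; by
      \<open>G_restrict\<close> and \<open>dG_restrict\<close> the functions do not see these
      coordinates.\<close>
    have ZR: "(\<lambda>j. (\<lambda>j\<in>J. R j x) j + U x * a j) = (\<lambda>j. if j \<in> J then Z j x else undefined + U x * a j)" for x
      by (auto simp: R_def fun_eq_iff)
    have G_if: "G (\<lambda>j. if j \<in> J then Z j x else f j) = G (\<lambda>j. Z j x)" for x f
      using G_restrict[of "\<lambda>j. if j \<in> J then Z j x else f j"] G_restrict[of "\<lambda>j. Z j x"] by (simp cong: restrict_cong)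
    have dG_if: "dG j (\<lambda>j. if j \<in> J then Z j x else f j) = dG j (\<lambda>j. Z j x)" if "j \<in> J" for x j f
      using dG_restrict[OF that, of "\<lambda>j. if j \<in> J then Z j x else f j"] dG_restrict[OF that, of "\<lambda>j. Z j x"] by (simp cong: restrict_cong)
    have \<Phi>Z: "\<Phi> (U x, \<lambda>j\<in>J. R j x) = G (\<lambda>j. Z j x)" for x by (simp only: \<Phi>_def split ZR G_if)
    have \<Psi>Z: "\<Psi> (U x, \<lambda>j\<in>J. R j x) = (\<Sum>j\<in>J. a j * dG j (\<lambda>j. Z j x))" for x
      unfolding \<Psi>_def split ZR by (intro sum.cong refl) (simp only: dG_if)
    have K: "0 \<le> K"
    proof -
      have "0 \<le> K * exp (k * (\<Sum>j\<in>J. \<bar>(\<lambda>_. 0::real) j\<bar>))" using G_bound[of "\<lambda>_. 0"] by (rule order_trans[OF abs_ge_zero])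
      then show ?thesis by simp
    qed
    have expZ: "integrable M (\<lambda>x. exp (c * (\<Sum>j\<in>J. \<bar>Z j x\<bar>)))" for c
      by (rule integrable_exp_sum_abs[OF J M Z centered_normal_exp_abs[OF ZN]])
    have ZPi: "(\<lambda>x. \<lambda>j\<in>J. Z j x) \<in> M \<rightarrow>\<^sub>M Pi\<^sub>M J (\<lambda>_. borel)" by (intro measurable_restrict) simp
    have GZ[measurable]: "(\<lambda>x. G (\<lambda>j. Z j x)) \<in> borel_measurable M"
      using measurable_compose[OF ZPi G_meas] by (simp add: G_restrict)
    have dGZ[measurable]: "(\<lambda>x. dG j (\<lambda>j. Z j x)) \<in> borel_measurable M" if "j \<in> J" for j
      using measurable_compose[OF ZPi dG_meas[OF that]] that by (simp add: dG_restrict)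
    have dG_int: "integrable M (\<lambda>x. dG j (\<lambda>j. Z j x))" if "j \<in> J" for j
    proof (rule Bochner_Integration.integrable_bound)
      show "integrable M (\<lambda>x. K * exp (k * (\<Sum>j\<in>J. \<bar>Z j x\<bar>)))" using expZ by simp
      show "AE x in M. norm (dG j (\<lambda>j. Z j x)) \<le> norm (K * exp (k * (\<Sum>j\<in>J. \<bar>Z j x\<bar>)))"
        unfolding real_norm_def by (intro AE_I2 order_trans[OF dG_bound[OF that] abs_ge_self])
    qed (use that in simp)
    have UG_int: "integrable M (\<lambda>x. U x * G (\<lambda>j. Z j x))"
    proof (rule Bochner_Integration.integrable_bound)
      show "integrable M (\<lambda>x. K * (exp (2 * \<bar>U x\<bar>) + exp (2 * k * (\<Sum>j\<in>J. \<bar>Z j x\<bar>))))"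
        by (intro integrable_mult_right Bochner_Integration.integrable_add expZ centered_normal_exp_abs[OF UN])
      have "\<bar>U x * G (\<lambda>j. Z j x)\<bar> \<le> K * (exp (2 * \<bar>U x\<bar>) + exp (2 * k * (\<Sum>j\<in>J. \<bar>Z j x\<bar>)))" for x
      proof -
        have "\<bar>U x\<bar> \<le> exp \<bar>U x\<bar>" using exp_ge_add_one_self[of "\<bar>U x\<bar>"] by linarith
        then have "\<bar>U x\<bar> * \<bar>G (\<lambda>j. Z j x)\<bar> \<le> exp \<bar>U x\<bar> * (K * exp (k * (\<Sum>j\<in>J. \<bar>Z j x\<bar>)))"
          using G_bound by (intro mult_mono) auto
        also have "\<dots> = K * exp (\<bar>U x\<bar> + k * (\<Sum>j\<in>J. \<bar>Z j x\<bar>))" by (simp add: exp_add)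
        also have "\<dots> \<le> K * (exp (2 * \<bar>U x\<bar>) + exp (2 * k * (\<Sum>j\<in>J. \<bar>Z j x\<bar>)))"
          using exp_add_le[of "\<bar>U x\<bar>" "k * (\<Sum>j\<in>J. \<bar>Z j x\<bar>)"] K by (intro mult_left_mono) (auto simp: mult.assoc)
        finally show ?thesis by (simp add: abs_mult)
      qed
      then show "AE x in M. norm (U x * G (\<lambda>j. Z j x)) \<le> norm (K * (exp (2 * \<bar>U x\<bar>) + exp (2 * k * (\<Sum>j\<in>J. \<bar>Z j x\<bar>))))"
        unfolding real_norm_def by (intro AE_I2) (rule order_trans[OF _ abs_ge_self])
    qed simp
    have "(\<integral>x. U x * \<Phi> (U x, \<lambda>j\<in>J. R j x) \<partial>M) = \<sigma>\<^sup>2 * (\<integral>x. \<Psi> (U x, \<lambda>j\<in>J. R j x) \<partial>M)"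
    proof (rule stein_conditional[OF M J U s R law m m'])
      show "integrable M (\<lambda>x. U x * \<Phi> (U x, \<lambda>j\<in>J. R j x))" unfolding \<Phi>Z by (rule UG_int)
      show "integrable M (\<lambda>x. \<Psi> (U x, \<lambda>j\<in>J. R j x))" unfolding \<Psi>Z using dG_int by auto
      show "((\<lambda>u. \<Phi> (u, r)) has_real_derivative \<Psi> (u, r)) (at u)" for u r
        unfolding \<Phi>_def \<Psi>_def split by (rule deriv)
      show "continuous_on UNIV (\<lambda>u. \<Psi> (u, r))" for r
        unfolding \<Psi>_def split by (intro continuous_intros cont)
      fix r :: "'i \<Rightarrow> real"
      let ?A = "\<Sum>j\<in>J. \<bar>a j\<bar>"
      let ?L = "K * exp (k * (\<Sum>j\<in>J. \<bar>r j\<bar>))"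
      have L: "?L \<ge> 0" using K by simp
      have e: "K * exp (k * (\<Sum>j\<in>J. \<bar>r j + u * a j\<bar>)) \<le> ?L * exp ((k * ?A) * \<bar>u\<bar>)" for u
      proof -
        have "(\<Sum>j\<in>J. \<bar>r j + u * a j\<bar>) \<le> (\<Sum>j\<in>J. \<bar>r j\<bar> + \<bar>u\<bar> * \<bar>a j\<bar>)"
          by (intro sum_mono order_trans[OF abs_triangle_ineq]) (simp add: abs_mult)
        also have "\<dots> = (\<Sum>j\<in>J. \<bar>r j\<bar>) + ?A * \<bar>u\<bar>" by (simp add: sum.distrib sum_distrib_left mult.commute)
        finally have "k * (\<Sum>j\<in>J. \<bar>r j + u * a j\<bar>) \<le> k * (\<Sum>j\<in>J. \<bar>r j\<bar>) + (k * ?A) * \<bar>u\<bar>"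
          using mult_left_mono[OF _ k] by (fastforce simp: distrib_left mult.assoc)
        then have "exp (k * (\<Sum>j\<in>J. \<bar>r j + u * a j\<bar>)) \<le> exp (k * (\<Sum>j\<in>J. \<bar>r j\<bar>)) * exp ((k * ?A) * \<bar>u\<bar>)"
          by (simp add: exp_add[symmetric])
        from mult_left_mono[OF this K] show ?thesis by (simp add: mult.assoc)
      qed
      \<comment> \<open>\<Phi> needs the factor 1 and \<Psi> the factor \<open>?A\<close>;
        \<open>1 + ?A\<close> covers both.\<close>
      have 1: "\<bar>\<Phi> (u, r)\<bar> \<le> ((1 + ?A) * ?L) * exp ((k * ?A) * \<bar>u\<bar>)" for u
      proof -
        have "\<bar>\<Phi> (u, r)\<bar> \<le> ?L * exp ((k * ?A) * \<bar>u\<bar>)"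
          unfolding \<Phi>_def split by (rule order_trans[OF G_bound e])
        also have "\<dots> \<le> ((1 + ?A) * ?L) * exp ((k * ?A) * \<bar>u\<bar>)"
          using L by (intro mult_right_mono) (auto simp: distrib_right sum_nonneg)
        finally show ?thesis .
      qed
      have 2: "\<bar>\<Psi> (u, r)\<bar> \<le> ((1 + ?A) * ?L) * exp ((k * ?A) * \<bar>u\<bar>)" for u
      proof -
        have "\<bar>\<Psi> (u, r)\<bar> \<le> (\<Sum>j\<in>J. \<bar>a j\<bar> * (?L * exp ((k * ?A) * \<bar>u\<bar>)))"
          unfolding \<Psi>_def split
          by (rule order_trans[OF sum_abs], rule sum_mono, unfold abs_mult, rule mult_left_mono, rule order_trans[OF dG_bound e]) auto
        also have "\<dots> = ?A * (?L * exp ((k * ?A) * \<bar>u\<bar>))" by (simp add: sum_distrib_right)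
        also have "\<dots> \<le> (1 + ?A) * (?L * exp ((k * ?A) * \<bar>u\<bar>))"
          using L by (intro mult_right_mono) auto
        finally show ?thesis by (simp add: mult.assoc)
      qed
      show "\<exists>K k. \<forall>u. \<bar>\<Phi> (u, r)\<bar> \<le> K * exp (k * \<bar>u\<bar>) \<and> \<bar>\<Psi> (u, r)\<bar> \<le> K * exp (k * \<bar>u\<bar>)"
        using 1 2 by blast
    qed
    then have "(\<integral>x. U x * G (\<lambda>j. Z j x) \<partial>M) = \<sigma>\<^sup>2 * (\<Sum>j\<in>J. a j * (\<integral>x. dG j (\<lambda>j. Z j x) \<partial>M))"
      using dG_int by (simp add: \<Phi>Z \<Psi>Z)
    then show ?thesis using False by (simp add: sum_distrib_left a_def)
  qed
qed

section \<open>Smooth maxima and minima\<close>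

text \<open>The bound \<open>g\<close> on the derivative does not depend on \<open>t\<close>, so by
  the mean value inequality it also bounds all difference quotients, and dominated convergence
  applies along every sequence tending to \<open>t\<close>.\<close>

lemma has_real_derivative_integral:
  fixes f f' :: "real \<Rightarrow> 'a \<Rightarrow> real"
  assumes f: "\<And>t. integrable M (f t)" and g: "integrable M g"
    and d: "\<And>t x. x \<in> space M \<Longrightarrow> ((\<lambda>t. f t x) has_real_derivative f' t x) (at t)"
    and f'm[measurable]: "\<And>t. f' t \<in> borel_measurable M"
    and b: "\<And>t x. x \<in> space M \<Longrightarrow> \<bar>f' t x\<bar> \<le> g x"
  shows "((\<lambda>t. \<integral>x. f t x \<partial>M) has_real_derivative (\<integral>x. f' t x \<partial>M)) (at t)"
  unfolding has_field_derivative_iff tendsto_at_iff_sequentially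
proof (intro allI impI)
  fix X :: "nat \<Rightarrow> real" assume X: "\<forall>i. X i \<in> UNIV - {t}" "X \<longlonglongrightarrow> t"
  note [measurable] = borel_measurable_integrable[OF f]
  have "(\<lambda>n. \<integral>x. (f (X n) x - f t x) / (X n - t) \<partial>M) \<longlonglongrightarrow> (\<integral>x. f' t x \<partial>M)"
  proof (rule integral_dominated_convergence[OF _ _ g])
    show "AE x in M. (\<lambda>n. (f (X n) x - f t x) / (X n - t)) \<longlonglongrightarrow> f' t x"
      using d[unfolded has_field_derivative_iff tendsto_at_iff_sequentially] X by (intro AE_I2) (auto simp: comp_def)
    show "AE x in M. norm ((f (X n) x - f t x) / (X n - t)) \<le> g x" for n
    proof (intro AE_I2)
      fix x assume x: "x \<in> space M"
      have "norm (f (X n) x - f t x) \<le> g x * norm (X n - t)"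
        by (rule field_differentiable_bound[of UNIV "\<lambda>t. f t x" "\<lambda>t. f' t x" "g x" "X n" t])
           (use d[OF x] b[OF x] in \<open>auto simp: has_field_derivative_at_within\<close>)
      then show "norm ((f (X n) x - f t x) / (X n - t)) \<le> g x"
        using X(1) by (simp add: divide_le_eq)
    qed
  qed auto
  moreover have "(\<integral>x. (f (X n) x - f t x) / (X n - t) \<partial>M) = ((\<integral>x. f (X n) x \<partial>M) - (\<integral>x. f t x \<partial>M)) / (X n - t)" for n
    using Bochner_Integration.integral_diff[OF f[of "X n"] f[of t]] by (simp only: integral_divide_zero)
  ultimately show "((\<lambda>y. ((\<integral>x. f y x \<partial>M) - (\<integral>x. f t x \<partial>M)) / (y - t)) \<circ> X) \<longlonglongrightarrow> (\<integral>x. f' t x \<partial>M)"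
    by (simp only: comp_def)
qed

section \<open>Log-sum-exp means, their gradient and their Hessian\<close>

definition exp_sum :: "'i set \<Rightarrow> real \<Rightarrow> ('i \<Rightarrow> real) \<Rightarrow> real" where
  "exp_sum J p y = (\<Sum>i\<in>J. exp (p * y i))"

text \<open>
  The logarithm of \<open>exp_mean\<close> lies within \<open>ln (card J) / \<bar>p\<bar>\<close> of the maximum of \<open>y\<close> over \<open>J\<close> if
  \<open>p > 0\<close>, and of the minimum if \<open>p < 0\<close>.
\<close>

definition exp_mean :: "'i set \<Rightarrow> real \<Rightarrow> ('i \<Rightarrow> real) \<Rightarrow> real" where
  "exp_mean J p y = exp (ln (exp_sum J p y) / p)"

text \<open>Softmax weights: for nonzero \<open>p\<close>, the gradient of
  \<open>ln (exp_mean J p y)\<close> in \<open>y\<close>.\<close>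

definition exp_weight :: "'i set \<Rightarrow> real \<Rightarrow> ('i \<Rightarrow> real) \<Rightarrow> 'i \<Rightarrow> real" where
  "exp_weight J p y i = exp (p * y i) / exp_sum J p y"

context
  fixes J :: "'i set" and p :: real
  assumes J: "finite J" "J \<noteq> {}" and p: "p \<noteq> 0"
begin

lemma exp_sum_pos: "0 < exp_sum J p y"
  unfolding exp_sum_def using J by (intro sum_pos) auto

lemma exp_mean_pos: "0 < exp_mean J p y"
  by (simp add: exp_mean_def)

lemma exp_weight_nonneg: "0 \<le> exp_weight J p y i"
  using exp_sum_pos[of y] by (simp add: exp_weight_def)

lemma exp_weight_sum: "(\<Sum>i\<in>J. exp_weight J p y i) = 1"
  using exp_sum_pos[of y] by (simp add: exp_weight_def sum_divide_distrib[symmetric] exp_sum_def[symmetric])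

lemma exp_weight_le_1: "i \<in> J \<Longrightarrow> exp_weight J p y i \<le> 1"
  using member_le_sum[of i J "exp_weight J p y"] J exp_weight_nonneg exp_weight_sum[of y] by auto

lemma exp_le_exp_sum: "i \<in> J \<Longrightarrow> exp (p * y i) \<le> exp_sum J p y"
  unfolding exp_sum_def by (rule member_le_sum) (use J in auto)

lemma ln_exp_sum_ge: "i \<in> J \<Longrightarrow> p * y i \<le> ln (exp_sum J p y)"
  using exp_le_exp_sum[of i y] exp_sum_pos[of y] by (simp add: ln_ge_iff)

lemma ln_exp_sum_le:
  assumes "\<And>i. i \<in> J \<Longrightarrow> p * y i \<le> b"
  shows "ln (exp_sum J p y) \<le> ln (card J) + b"
proof -
  have c: "0 < real (card J)" using J by (simp add: card_gt_0_iff)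
  have "exp_sum J p y \<le> card J * exp b"
    unfolding exp_sum_def by (rule sum_bounded_above) (use assms in auto)
  then have "ln (exp_sum J p y) \<le> ln (card J * exp b)"
    using exp_sum_pos[of y] by simp
  then show ?thesis using c by (simp add: ln_mult)
qed

lemma exp_mean_ge: "p > 0 \<Longrightarrow> i \<in> J \<Longrightarrow> exp (y i) \<le> exp_mean J p y"
  using ln_exp_sum_ge[of i y] by (simp add: exp_mean_def pos_le_divide_eq mult.commute)

lemma exp_mean_le:
  assumes "p > 0" "\<And>i. i \<in> J \<Longrightarrow> y i \<le> b"
  shows "exp_mean J p y \<le> exp (ln (card J) / p) * exp b"
proof -
  have "ln (exp_sum J p y) \<le> ln (card J) + p * b"
    by (rule ln_exp_sum_le) (use assms in auto)
  then have "ln (exp_sum J p y) / p \<le> (ln (card J) + p * b) / p"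
    using assms(1) by (intro divide_right_mono) auto
  then show ?thesis using assms(1) by (simp add: exp_mean_def exp_add[symmetric] add_divide_distrib)
qed

lemma exp_mean_neg_le: "p < 0 \<Longrightarrow> i \<in> J \<Longrightarrow> exp_mean J p y \<le> exp (y i)"
  using ln_exp_sum_ge[of i y] by (simp add: exp_mean_def neg_divide_le_eq mult.commute)

lemma exp_mean_neg_ge:
  assumes "p < 0" "\<And>i. i \<in> J \<Longrightarrow> b \<le> y i"
  shows "exp (ln (card J) / p) * exp b \<le> exp_mean J p y"
proof -
  have "ln (exp_sum J p y) \<le> ln (card J) + p * b"
    by (rule ln_exp_sum_le) (use assms in auto)
  then have "(ln (card J) + p * b) / p \<le> ln (exp_sum J p y) / p"
    using assms(1) by (intro divide_right_mono_neg) auto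
  then show ?thesis using assms(1) by (simp add: exp_mean_def exp_add[symmetric] add_divide_distrib)
qed

text \<open>Covers both signs of \<open>p\<close>, so that the domination estimates need no case
  distinction.\<close>

lemma exp_mean_bound: "exp_mean J p y \<le> exp \<bar>ln (card J) / p\<bar> * exp (\<Sum>i\<in>J. \<bar>y i\<bar>)"
proof (cases "p > 0")
  case True
  have "y i \<le> (\<Sum>i\<in>J. \<bar>y i\<bar>)" if "i \<in> J" for i
    using member_le_sum[OF that, of "\<lambda>i. \<bar>y i\<bar>"] J by auto
  then have "exp_mean J p y \<le> exp (ln (card J) / p) * exp (\<Sum>i\<in>J. \<bar>y i\<bar>)" by (rule exp_mean_le[OF True])
  also have "\<dots> \<le> exp \<bar>ln (card J) / p\<bar> * exp (\<Sum>i\<in>J. \<bar>y i\<bar>)"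
    by (intro mult_right_mono, unfold exp_le_cancel_iff, rule abs_ge_self, simp)
  finally show ?thesis .
next
  case False
  then have "p < 0" using p by auto
  obtain i where i: "i \<in> J" using J by auto
  have "exp_mean J p y \<le> 1 * exp (y i)" using exp_mean_neg_le[OF \<open>p < 0\<close> i] by simp
  also have "y i \<le> (\<Sum>i\<in>J. \<bar>y i\<bar>)" using member_le_sum[OF i, of "\<lambda>i. \<bar>y i\<bar>"] J by auto
  then have "1 * exp (y i) \<le> exp \<bar>ln (card J) / p\<bar> * exp (\<Sum>i\<in>J. \<bar>y i\<bar>)" by (intro mult_mono) auto
  finally show ?thesis .
qed

lemma exp_sum_cong: "(\<And>i. i \<in> J \<Longrightarrow> y i = y' i) \<Longrightarrow> exp_sum J p y = exp_sum J p y'"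
  unfolding exp_sum_def by (intro sum.cong) auto

lemma exp_mean_cong: "(\<And>i. i \<in> J \<Longrightarrow> y i = y' i) \<Longrightarrow> exp_mean J p y = exp_mean J p y'"
  unfolding exp_mean_def using exp_sum_cong[of y y'] by simp

lemma exp_weight_cong: "(\<And>i. i \<in> J \<Longrightarrow> y i = y' i) \<Longrightarrow> i \<in> J \<Longrightarrow> exp_weight J p y i = exp_weight J p y' i"
  unfolding exp_weight_def using exp_sum_cong[of y y'] by simp

lemma measurable_exp_sum:
  "(\<And>i. i \<in> J \<Longrightarrow> (\<lambda>x. y x i) \<in> borel_measurable M) \<Longrightarrow> (\<lambda>x. exp_sum J p (y x)) \<in> borel_measurable M"
  unfolding exp_sum_def by measurable

lemma measurable_exp_mean:
  "(\<And>i. i \<in> J \<Longrightarrow> (\<lambda>x. y x i) \<in> borel_measurable M) \<Longrightarrow> (\<lambda>x. exp_mean J p (y x)) \<in> borel_measurable M"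
  unfolding exp_mean_def
  by (intro measurable_compose[OF _ borel_measurable_exp] borel_measurable_divide borel_measurable_ln measurable_exp_sum) auto

lemma measurable_exp_weight:
  "(\<And>i. i \<in> J \<Longrightarrow> (\<lambda>x. y x i) \<in> borel_measurable M) \<Longrightarrow> i \<in> J \<Longrightarrow> (\<lambda>x. exp_weight J p (y x) i) \<in> borel_measurable M"
  unfolding exp_weight_def
  by (intro measurable_compose[OF _ borel_measurable_exp] borel_measurable_divide borel_measurable_times measurable_exp_sum) auto

lemma exp_sum_deriv:
  assumes "\<And>i. i \<in> J \<Longrightarrow> ((\<lambda>t. y t i) has_real_derivative y' i) (at t)"
  shows "((\<lambda>t. exp_sum J p (y t)) has_real_derivative exp_sum J p (y t) * (p * (\<Sum>i\<in>J. exp_weight J p (y t) i * y' i))) (at t)"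
proof -
  have "((\<lambda>t. exp_sum J p (y t)) has_real_derivative (\<Sum>i\<in>J. exp (p * y t i) * (p * y' i))) (at t)"
    unfolding exp_sum_def by (intro DERIV_sum) (auto intro!: derivative_eq_intros assms)
  moreover have "exp (p * y t i) = exp_sum J p (y t) * exp_weight J p (y t) i" for i
    using exp_sum_pos[of "y t"] by (simp add: exp_weight_def)
  ultimately show ?thesis by (simp add: sum_distrib_left mult_ac)
qed

lemma exp_mean_deriv:
  assumes "\<And>i. i \<in> J \<Longrightarrow> ((\<lambda>t. y t i) has_real_derivative y' i) (at t)"
  shows "((\<lambda>t. exp_mean J p (y t)) has_real_derivative exp_mean J p (y t) * (\<Sum>i\<in>J. exp_weight J p (y t) i * y' i)) (at t)"
  unfolding exp_mean_def
  using exp_sum_pos[of "y t"] p by (auto intro!: derivative_eq_intros exp_sum_deriv assms)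

lemma exp_weight_deriv:
  assumes "\<And>i. i \<in> J \<Longrightarrow> ((\<lambda>t. y t i) has_real_derivative y' i) (at t)" and "i \<in> J"
  shows "((\<lambda>t. exp_weight J p (y t) i) has_real_derivative
    p * exp_weight J p (y t) i * (y' i - (\<Sum>j\<in>J. exp_weight J p (y t) j * y' j))) (at t)"
proof -
  \<comment> \<open>In exponential form the logarithmic derivative is a difference of two known
    terms.\<close>
  have w: "exp_weight J p y i = exp (p * y i - ln (exp_sum J p y))" for y
    using exp_sum_pos[of y] by (simp add: exp_weight_def exp_diff)
  let ?d = "\<Sum>j\<in>J. exp_weight J p (y t) j * y' j"
  have "((\<lambda>t. exp (p * y t i - ln (exp_sum J p (y t)))) has_real_derivative
    exp (p * y t i - ln (exp_sum J p (y t))) * (p * y' i - p * ?d)) (at t)"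
    using exp_sum_pos[of "y t"] assms(2) by (auto intro!: derivative_eq_intros exp_sum_deriv assms(1))
  then show ?thesis unfolding w[symmetric] by (simp add: algebra_simps)
qed

definition exp_grad :: "'i \<Rightarrow> ('i \<Rightarrow> real) \<Rightarrow> real" where
  "exp_grad i y = exp_mean J p y * exp_weight J p y i"

text \<open>Product rule for mean times weight \<open>w i\<close>: differentiating the mean
  contributes \<open>w i * w j\<close>, differentiating the weight contributes
  \<open>p * w i * (\<delta> - w j)\<close> with \<delta> the Kronecker symbol, both times the
  mean.\<close>

definition exp_hess :: "'i \<Rightarrow> 'i \<Rightarrow> ('i \<Rightarrow> real) \<Rightarrow> real" where
  "exp_hess i j y = exp_mean J p y * exp_weight J p y i * ((1 - p) * exp_weight J p y j + (if i = j then p else 0))"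

lemma exp_grad_deriv:
  assumes "\<And>i. i \<in> J \<Longrightarrow> ((\<lambda>t. y t i) has_real_derivative y' i) (at t)" and i: "i \<in> J"
  shows "((\<lambda>t. exp_grad i (y t)) has_real_derivative (\<Sum>j\<in>J. y' j * exp_hess i j (y t))) (at t)"
proof -
  let ?F = "exp_mean J p (y t)" and ?w = "exp_weight J p (y t)"
  let ?d = "\<Sum>j\<in>J. ?w j * y' j"
  have "(\<Sum>j\<in>J. y' j * exp_hess i j (y t)) = ?F * ?w i * (\<Sum>j\<in>J. (1 - p) * (?w j * y' j) + (if i = j then p * y' j else 0))"
    unfolding exp_hess_def sum_distrib_left by (intro sum.cong refl) (simp add: algebra_simps)
  also have "\<dots> = ?F * ?w i * ((1 - p) * ?d + p * y' i)"
    using J i by (simp add: sum.distrib sum_distrib_left[symmetric])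
  also have "\<dots> = ?F * ?d * ?w i + p * ?w i * (y' i - ?d) * ?F" by (simp add: algebra_simps)
  finally show ?thesis unfolding exp_grad_def
    using DERIV_mult[OF exp_mean_deriv[OF assms(1)] exp_weight_deriv[OF assms]] by simp
qed

lemma exp_grad_bound:
  assumes "i \<in> J" shows "\<bar>exp_grad i y\<bar> \<le> exp \<bar>ln (card J) / p\<bar> * exp (\<Sum>i\<in>J. \<bar>y i\<bar>)"
proof -
  have "\<bar>exp_grad i y\<bar> \<le> exp_mean J p y"
    unfolding exp_grad_def using exp_mean_pos[of y] exp_weight_nonneg[of y i] exp_weight_le_1[OF assms]
    by (simp add: abs_mult mult_left_le)
  then show ?thesis using exp_mean_bound by (rule order_trans)
qed

lemma exp_hess_bound:
  assumes "i \<in> J" "j \<in> J" shows "\<bar>exp_hess i j y\<bar> \<le> (1 + 2 * \<bar>p\<bar>) * (exp \<bar>ln (card J) / p\<bar> * exp (\<Sum>i\<in>J. \<bar>y i\<bar>))"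
proof -
  \<comment> \<open>\<open>\<bar>1 - p\<bar>\<close> is at most \<open>1 + \<bar>p\<bar>\<close>,
    and the diagonal entry adds another \<open>\<bar>p\<bar>\<close>.\<close>
  have "\<bar>(1 - p) * exp_weight J p y j\<bar> \<le> (1 + \<bar>p\<bar>) * 1"
    unfolding abs_mult using exp_weight_nonneg[of y j] exp_weight_le_1[OF assms(2)] by (intro mult_mono) auto
  then have "\<bar>(1 - p) * exp_weight J p y j + (if i = j then p else 0)\<bar> \<le> 1 + 2 * \<bar>p\<bar>" by auto
  then have "\<bar>exp_hess i j y\<bar> \<le> (exp \<bar>ln (card J) / p\<bar> * exp (\<Sum>i\<in>J. \<bar>y i\<bar>)) * (1 + 2 * \<bar>p\<bar>)"
    unfolding exp_hess_def exp_grad_def[symmetric] abs_mult using exp_grad_bound[OF assms(1)]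
    by (intro mult_mono) auto
  then show ?thesis by (simp add: mult.commute)
qed

end

section \<open>Interpolation between Gaussian vectors\<close>

text \<open>Joint normality \<open>cn\<close> and vanishing cross covariances \<open>orth\<close>
  are the form in which independence of the two vectors enters. The factor \<open>p - 1\<close>
  stays in the conclusion, so that one inequality serves \<open>p > 1\<close> and, with the opposite
  effect, \<open>p < 0\<close>.\<close>

lemma gaussian_interpolation:
  fixes P :: "'a measure" and X Y :: "'i \<Rightarrow> 'a \<Rightarrow> real"
  assumes P: "prob_space P" and J: "finite J" "J \<noteq> {}" and p: "p \<noteq> 0"
    and cn: "\<And>a b. centered_normal P (\<lambda>x. \<Sum>j\<in>J. a j * X j x + b j * Y j x)"
    and orth: "\<And>i j. i \<in> J \<Longrightarrow> j \<in> J \<Longrightarrow> (\<integral>x. X i x * Y j x \<partial>P) = 0"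
  defines "A \<equiv> \<lambda>i j. \<integral>x. X i x * X j x \<partial>P" and "B \<equiv> \<lambda>i j. \<integral>x. Y i x * Y j x \<partial>P"
  assumes le: "\<And>i j. i \<in> J \<Longrightarrow> j \<in> J \<Longrightarrow> A i i + A j j - 2 * A i j \<le> B i i + B j j - 2 * B i j"
  shows "0 \<le> (p - 1) * ((\<integral>x. exp_mean J p (\<lambda>j. sqrt 2 * Y j x - B j j) \<partial>P) - (\<integral>x. exp_mean J p (\<lambda>j. sqrt 2 * X j x - A j j) \<partial>P))"
    (is "0 \<le> (p - 1) * (?hY - ?hX)")
proof -
  interpret P: prob_space P by fact
  note E = J p
  have XN: "centered_normal P (X j)" and YN: "centered_normal P (Y j)" if "j \<in> J" for j
  proof -
    have "(\<Sum>i\<in>J. (if i = j then 1 else 0) * X i x + 0 * Y i x) = X j x" "(\<Sum>i\<in>J. 0 * X i x + (if i = j then 1 else 0) * Y i x) = Y j x" for x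
      using J that by (simp_all add: if_distrib[of "\<lambda>u. u * _"] cong: if_cong)
    then show "centered_normal P (X j)" "centered_normal P (Y j)"
      using cn[of "\<lambda>i. if i = j then 1 else 0" "\<lambda>_. 0"] cn[of "\<lambda>_. 0" "\<lambda>i. if i = j then 1 else 0"] by simp_all
  qed
  have X[measurable]: "X j \<in> borel_measurable P" and Y[measurable]: "Y j \<in> borel_measurable P" if "j \<in> J" for j
    using that XN YN by (auto dest: centered_normalD)
  have prods: "integrable P (\<lambda>x. X i x * X j x)" "integrable P (\<lambda>x. X i x * Y j x)" "integrable P (\<lambda>x. Y i x * X j x)" "integrable P (\<lambda>x. Y i x * Y j x)"
    if "i \<in> J" "j \<in> J" for i j
    by (intro integrable_mult_of_squares X Y XN YN centered_normal_integrable(3) that)+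
  have orth': "(\<integral>x. Y j x * X i x \<partial>P) = 0" if "i \<in> J" "j \<in> J" for i j
    using orth[OF that] by (simp add: mult.commute)
  have A0: "0 \<le> A j j" and B0: "0 \<le> B j j" for j
    unfolding A_def B_def by (auto intro!: integral_nonneg_AE)
  \<comment> \<open>A common dominating variable: the estimates uniform in \<open>t\<close> take the
    form \<open>K * exp (c * S x)\<close>.\<close>
  define S where "S x = (\<Sum>j\<in>J. \<bar>X j x\<bar> + \<bar>Y j x\<bar>)" for x
  have expS: "integrable P (\<lambda>x. exp (c * S x))" for c
  proof (rule Bochner_Integration.integrable_bound)
    show "integrable P (\<lambda>x. exp (2 * c * (\<Sum>j\<in>J. \<bar>X j x\<bar>)) + exp (2 * c * (\<Sum>j\<in>J. \<bar>Y j x\<bar>)))"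
      by (intro Bochner_Integration.integrable_add integrable_exp_sum_abs J P X Y centered_normal_exp_abs XN YN)
    show "AE x in P. norm (exp (c * S x)) \<le> norm (exp (2 * c * (\<Sum>j\<in>J. \<bar>X j x\<bar>)) + exp (2 * c * (\<Sum>j\<in>J. \<bar>Y j x\<bar>)))"
      using exp_add_le[of "c * (\<Sum>j\<in>J. \<bar>X j _\<bar>)" "c * (\<Sum>j\<in>J. \<bar>Y j _\<bar>)"]
      by (intro AE_I2) (simp add: S_def sum.distrib distrib_left abs_of_pos add_pos_pos mult.assoc)
    have "S \<in> borel_measurable P" unfolding S_def
      by (intro borel_measurable_sum borel_measurable_add borel_measurable_abs X Y)
    then show "(\<lambda>x. exp (c * S x)) \<in> borel_measurable P" by measurable
  qed
  have S0: "0 \<le> S x" for x unfolding S_def by (intro sum_nonneg) auto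

  \<comment> \<open>\<open>U\<close> is the derivative of \<open>Z\<close> in \<open>t\<close>.
    Because the cross covariances vanish, \<open>v t j\<close> is the variance of
    \<open>Z t j\<close>, so \<open>y\<close> is the exponent belonging to the interpolated
    vector.\<close>
  define Z where "Z t j x = cos t * X j x + sin t * Y j x" for t j x
  define U where "U t j x = - sin t * X j x + cos t * Y j x" for t j x
  define v where "v t j = (cos t)\<^sup>2 * A j j + (sin t)\<^sup>2 * B j j" for t j
  define v' where "v' t j = 2 * (sin t * cos t) * (B j j - A j j)" for t j
  define y where "y t x j = sqrt 2 * Z t j x - v t j" for t x j
  define y' where "y' t x j = sqrt 2 * U t j x - v' t j" for t x j
  \<comment> \<open>\<open>Q\<close> bounds the subtracted variances uniformly in \<open>t\<close>;
    \<open>C\<close> is the prefactor in \<open>exp_mean_bound\<close>.\<close>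
  define Q where "Q = (\<Sum>j\<in>J. A j j + B j j)"
  define C where "C = exp \<bar>ln (card J) / p\<bar>"
  have ym: "(\<lambda>x. y t x j) \<in> borel_measurable P" if "j \<in> J" for t j
    unfolding y_def Z_def using X[OF that] Y[OF that] by measurable
  have ym': "(\<lambda>x. y' t x j) \<in> borel_measurable P" if "j \<in> J" for t j
    unfolding y'_def U_def using X[OF that] Y[OF that] by measurable
  have Fm: "(\<lambda>x. exp_mean J p (y t x)) \<in> borel_measurable P" for t
    by (intro measurable_exp_mean E ym)
  have wm: "(\<lambda>x. exp_weight J p (y t x) i) \<in> borel_measurable P" if "i \<in> J" for t i
    by (intro measurable_exp_weight E ym that)
  have gm: "(\<lambda>x. exp_grad J p i (y t x)) \<in> borel_measurable P" if "i \<in> J" for t i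
    unfolding exp_grad_def[OF E] by (intro borel_measurable_times Fm wm that)
  have hm: "(\<lambda>x. exp_hess J p i j (y t x)) \<in> borel_measurable P" if "i \<in> J" "j \<in> J" for t i j
    unfolding exp_hess_def[OF E] by (intro borel_measurable_times borel_measurable_add borel_measurable_const Fm wm that)
  have dy: "((\<lambda>t. y t x j) has_real_derivative y' t x j) (at t)" for t x j
    unfolding y_def y'_def Z_def U_def v_def v'_def
    by (auto intro!: derivative_eq_intros simp: algebra_simps power2_eq_square)
  have trig: "\<bar>cos t\<bar> \<le> 1" "\<bar>sin t\<bar> \<le> 1" "(cos t)\<^sup>2 \<le> 1" "(sin t)\<^sup>2 \<le> 1" for t :: real
    by (auto simp: abs_square_le_1)
  have Zb: "\<bar>Z t j x\<bar> \<le> \<bar>X j x\<bar> + \<bar>Y j x\<bar>" for t j x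
  proof -
    have "\<bar>cos t * X j x\<bar> \<le> 1 * \<bar>X j x\<bar>" "\<bar>sin t * Y j x\<bar> \<le> 1 * \<bar>Y j x\<bar>"
      unfolding abs_mult by (intro mult_right_mono trig abs_ge_zero)+
    then show ?thesis unfolding Z_def by linarith
  qed
  have Ub: "\<bar>U t j x\<bar> \<le> \<bar>X j x\<bar> + \<bar>Y j x\<bar>" for t j x
  proof -
    have "\<bar>sin t * X j x\<bar> \<le> 1 * \<bar>X j x\<bar>" "\<bar>cos t * Y j x\<bar> \<le> 1 * \<bar>Y j x\<bar>"
      unfolding abs_mult by (intro mult_right_mono trig abs_ge_zero)+
    then show ?thesis unfolding U_def by (simp add: abs_real_def split: if_splits)
  qed
  have vb: "\<bar>v t j\<bar> \<le> A j j + B j j" for t j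
  proof -
    have "(cos t)\<^sup>2 * A j j \<le> 1 * A j j" "(sin t)\<^sup>2 * B j j \<le> 1 * B j j" by (intro mult_right_mono trig A0 B0)+
    moreover have "0 \<le> (cos t)\<^sup>2 * A j j" "0 \<le> (sin t)\<^sup>2 * B j j" by (intro mult_nonneg_nonneg A0 B0; simp)+
    ultimately show ?thesis unfolding v_def by linarith
  qed
  have vb': "\<bar>v' t j\<bar> \<le> 2 * (A j j + B j j)" for t j
  proof -
    have "\<bar>sin t * cos t\<bar> \<le> 1 * 1" unfolding abs_mult by (intro mult_mono trig) auto
    moreover have "\<bar>B j j - A j j\<bar> \<le> A j j + B j j" using A0[of j] B0[of j] by linarith
    ultimately have "\<bar>sin t * cos t\<bar> * \<bar>B j j - A j j\<bar> \<le> 1 * (A j j + B j j)" by (intro mult_mono) auto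
    then show ?thesis by (simp add: v'_def abs_mult)
  qed
  have yb: "(\<Sum>j\<in>J. \<bar>y t x j\<bar>) \<le> sqrt 2 * S x + Q" for t x
  proof -
    have "(\<Sum>j\<in>J. \<bar>y t x j\<bar>) \<le> (\<Sum>j\<in>J. sqrt 2 * (\<bar>X j x\<bar> + \<bar>Y j x\<bar>) + (A j j + B j j))"
    proof (rule sum_mono)
      fix j
      have "\<bar>sqrt 2 * Z t j x\<bar> \<le> sqrt 2 * (\<bar>X j x\<bar> + \<bar>Y j x\<bar>)" using Zb[of t j x] by (simp add: abs_mult)
      then show "\<bar>y t x j\<bar> \<le> sqrt 2 * (\<bar>X j x\<bar> + \<bar>Y j x\<bar>) + (A j j + B j j)"
        unfolding y_def using vb[of t j] by linarith
    qed
    then show ?thesis by (simp add: S_def Q_def sum.distrib sum_distrib_left distrib_left)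
  qed
  have C0: "0 < C" by (simp add: C_def)
  have Cy: "C * exp (\<Sum>j\<in>J. \<bar>y t x j\<bar>) \<le> C * exp Q * exp (sqrt 2 * S x)" for t x
    using yb[of t x] C0 by (simp add: mult.assoc exp_add[symmetric] add.commute)
  have Fb: "\<bar>exp_mean J p (y t x)\<bar> \<le> C * exp Q * exp (sqrt 2 * S x)" for t x
    using order_trans[OF exp_mean_bound[OF E, of "y t x"] Cy[unfolded C_def]] exp_mean_pos[OF E, of "y t x"]
    by (simp only: C_def abs_of_pos)
  have gb: "\<bar>exp_grad J p i (y t x)\<bar> \<le> C * exp Q * exp (sqrt 2 * S x)" if "i \<in> J" for i t x
    using order_trans[OF exp_grad_bound[OF E that, of "y t x"] Cy[unfolded C_def]] by (simp only: C_def)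
  have hb: "\<bar>exp_hess J p i j (y t x)\<bar> \<le> (1 + 2 * \<bar>p\<bar>) * (C * exp Q * exp (sqrt 2 * S x))" if "i \<in> J" "j \<in> J" for i j t x
    by (rule order_trans[OF exp_hess_bound[OF E that, of "y t x"]], rule mult_left_mono)
       (use Cy in \<open>auto simp only: C_def\<close>)
  have bound_int: "integrable P f" if "f \<in> borel_measurable P" "\<And>x. \<bar>f x\<bar> \<le> K * exp (c * S x)" for f :: "'a \<Rightarrow> real" and K c
  proof (rule Bochner_Integration.integrable_bound)
    show "integrable P (\<lambda>x. K * exp (c * S x))" using expS by simp
    show "AE x in P. norm (f x) \<le> norm (K * exp (c * S x))"
      unfolding real_norm_def by (intro AE_I2 order_trans[OF that(2) abs_ge_self])
  qed fact
  have F_int: "integrable P (\<lambda>x. exp_mean J p (y t x))" for t by (rule bound_int[OF Fm Fb])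
  have g_int: "integrable P (\<lambda>x. exp_grad J p i (y t x))" if "i \<in> J" for t i by (rule bound_int[OF gm gb]; fact)
  have h_int: "integrable P (\<lambda>x. exp_hess J p i j (y t x))" if "i \<in> J" "j \<in> J" for t i j
    by (rule bound_int[OF hm[OF that], of _ "(1 + 2 * \<bar>p\<bar>) * (C * exp Q)" "sqrt 2"])
       (use hb[OF that] in \<open>simp only: mult.assoc\<close>)
  define h' where "h' t x = (\<Sum>i\<in>J. exp_grad J p i (y t x) * y' t x i)" for t x
  have yb': "\<bar>y' t x i\<bar> \<le> (1 + 2 * Q) * exp (sqrt 2 * S x)" if i: "i \<in> J" for t x i
  proof -
    have "\<bar>X i x\<bar> + \<bar>Y i x\<bar> \<le> S x" unfolding S_def
      using member_le_sum[OF i, of "\<lambda>i. \<bar>X i x\<bar> + \<bar>Y i x\<bar>"] J by auto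
    then have 1: "\<bar>sqrt 2 * U t i x\<bar> \<le> sqrt 2 * S x" using Ub[of t i x] by (simp add: abs_mult)
    have 2: "\<bar>v' t i\<bar> \<le> 2 * Q" using vb'[of t i] member_le_sum[OF i, of "\<lambda>i. A i i + B i i"] J A0 B0 unfolding Q_def by force
    have Q0: "0 \<le> Q" unfolding Q_def by (intro sum_nonneg add_nonneg_nonneg A0 B0)
    have 3: "sqrt 2 * S x \<le> exp (sqrt 2 * S x)" using exp_ge_add_one_self[of "sqrt 2 * S x"] by linarith
    have "1 \<le> exp (sqrt 2 * S x)" using S0 by simp
    then have "2 * Q * 1 \<le> 2 * Q * exp (sqrt 2 * S x)" using Q0 by (intro mult_left_mono) auto
    then show ?thesis unfolding y'_def using 1 2 3 by (simp add: distrib_right)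
  qed
  have h'b: "\<bar>h' t x\<bar> \<le> (card J * (C * exp Q * (1 + 2 * Q))) * exp (2 * sqrt 2 * S x)" for t x
  proof -
    have "\<bar>h' t x\<bar> \<le> (\<Sum>i\<in>J. \<bar>exp_grad J p i (y t x) * y' t x i\<bar>)" unfolding h'_def by (rule sum_abs)
    also have "\<dots> \<le> (\<Sum>i\<in>J. (C * exp Q * exp (sqrt 2 * S x)) * ((1 + 2 * Q) * exp (sqrt 2 * S x)))"
      unfolding abs_mult by (intro sum_mono mult_mono gb yb') (use C0 in auto)
    also have "\<dots> = (card J * (C * exp Q * (1 + 2 * Q))) * (exp (sqrt 2 * S x) * exp (sqrt 2 * S x))" by simp
    also have "exp (sqrt 2 * S x) * exp (sqrt 2 * S x) = exp (2 * sqrt 2 * S x)" by (simp add: exp_add[symmetric])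
    finally show ?thesis .
  qed
  have h'm: "h' t \<in> borel_measurable P" for t
    unfolding h'_def by (intro borel_measurable_sum borel_measurable_times gm ym')
  have deriv: "((\<lambda>t. \<integral>x. exp_mean J p (y t x) \<partial>P) has_real_derivative (\<integral>x. h' t x \<partial>P)) (at t)" for t
  proof (rule has_real_derivative_integral[OF F_int])
    show "integrable P (\<lambda>x. (card J * (C * exp Q * (1 + 2 * Q))) * exp (2 * sqrt 2 * S x))" using expS by simp
    show "((\<lambda>t. exp_mean J p (y t x)) has_real_derivative h' t x) (at t)" for t x
      using exp_mean_deriv[OF E, of "\<lambda>t. y t x" "y' t x" t] dy
      by (simp add: h'_def exp_grad_def[OF E] sum_distrib_left mult.assoc)
  qed (use h'b h'm in auto)

  \<comment> \<open>For \<open>i = j\<close> this is half of \<open>v' t i\<close>; therefore the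
    drift of the subtracted variance can be merged with the diagonal of the Hessian.\<close>
  have cov: "(\<integral>x. U t i x * Z t j x \<partial>P) = sin t * cos t * (B i j - A i j)" if "i \<in> J" "j \<in> J" for t i j
  proof -
    have "U t i x * Z t j x = - (sin t * cos t) * (X i x * X j x) + (- (sin t)\<^sup>2) * (X i x * Y j x) + (cos t)\<^sup>2 * (Y i x * X j x) + (sin t * cos t) * (Y i x * Y j x)" for x
      by (simp add: U_def Z_def algebra_simps power2_eq_square)
    then have "(\<integral>x. U t i x * Z t j x \<partial>P) = - (sin t * cos t) * A i j + (- (sin t)\<^sup>2) * (\<integral>x. X i x * Y j x \<partial>P)
        + (cos t)\<^sup>2 * (\<integral>x. Y i x * X j x \<partial>P) + (sin t * cos t) * B i j"
      unfolding A_def B_def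
      by (simp only: Bochner_Integration.integral_add Bochner_Integration.integrable_add integrable_mult_right integral_mult_right_zero prods[OF that])
    then show ?thesis using orth[OF that] orth'[OF that(2,1)] by (simp add: right_diff_distrib)
  qed
  have stein: "(\<integral>x. U t i x * exp_grad J p i (y t x) \<partial>P) = (\<Sum>j\<in>J. sin t * cos t * (B i j - A i j) * (sqrt 2 * (\<integral>x. exp_hess J p i j (y t x) \<partial>P)))"
    if i: "i \<in> J" for t i
  proof -
    let ?V = "\<Sum>j\<in>J. \<bar>v t j\<bar>"
    \<comment> \<open>The gradient alone would need \<open>C * exp ?V\<close>; the factor
      \<open>1 + 2 * \<bar>p\<bar>\<close> comes from the Hessian bound and \<open>sqrt 2\<close>
      from the chain rule.\<close>
    let ?K = "sqrt 2 * ((1 + 2 * \<bar>p\<bar>) * (C * exp ?V))"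
    have sb: "(\<Sum>j\<in>J. \<bar>sqrt 2 * z j - v t j\<bar>) \<le> sqrt 2 * (\<Sum>j\<in>J. \<bar>z j\<bar>) + ?V" for z
    proof -
      have "(\<Sum>j\<in>J. \<bar>sqrt 2 * z j - v t j\<bar>) \<le> (\<Sum>j\<in>J. sqrt 2 * \<bar>z j\<bar> + \<bar>v t j\<bar>)"
        by (intro sum_mono order_trans[OF abs_triangle_ineq4]) (simp add: abs_mult)
      then show ?thesis by (simp add: sum.distrib sum_distrib_left)
    qed
    have eb: "C * exp (\<Sum>j\<in>J. \<bar>sqrt 2 * z j - v t j\<bar>) \<le> C * exp ?V * exp (sqrt 2 * (\<Sum>j\<in>J. \<bar>z j\<bar>))" for z
      using sb[of z] C0 by (simp add: mult.assoc exp_add[symmetric] add.commute)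
    have meas: "(\<lambda>z. sqrt 2 * z j - v t j) \<in> borel_measurable (Pi\<^sub>M J (\<lambda>_. borel))" if "j \<in> J" for j
      using measurable_component_singleton[OF that, of "\<lambda>_. borel"] by measurable
    have s2: "1 \<le> sqrt 2" by simp
    have "(\<integral>x. U t i x * exp_grad J p i (\<lambda>j. sqrt 2 * Z t j x - v t j) \<partial>P)
        = (\<Sum>j\<in>J. (\<integral>x. U t i x * Z t j x \<partial>P) * (\<integral>x. sqrt 2 * exp_hess J p i j (\<lambda>j. sqrt 2 * Z t j x - v t j) \<partial>P))"
    proof (rule stein_gaussian_vector[OF P J(1), where k="sqrt 2" and K="?K"
          and G="\<lambda>z. exp_grad J p i (\<lambda>j. sqrt 2 * z j - v t j)" and dG="\<lambda>j z. sqrt 2 * exp_hess J p i j (\<lambda>j. sqrt 2 * z j - v t j)"])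
      \<comment> \<open>A combination of \<open>U t i\<close> and the \<open>Z t j\<close> is again
        one of the \<open>X j\<close> and \<open>Y j\<close>, so \<open>cn\<close> applies.\<close>
      fix u c
      have "u * U t i x + (\<Sum>j\<in>J. c j * Z t j x)
        = (\<Sum>j\<in>J. (c j * cos t - (if j = i then u * sin t else 0)) * X j x + (c j * sin t + (if j = i then u * cos t else 0)) * Y j x)" for x
      proof -
        have "(\<Sum>j\<in>J. (c j * cos t - (if j = i then u * sin t else 0)) * X j x + (c j * sin t + (if j = i then u * cos t else 0)) * Y j x)
          = (\<Sum>j\<in>J. c j * Z t j x + (if j = i then u * U t i x else 0))"
          by (intro sum.cong refl) (auto simp: Z_def U_def algebra_simps)
        then show ?thesis using i J by (simp add: sum.distrib)
      qed
      then show "centered_normal P (\<lambda>x. u * U t i x + (\<Sum>j\<in>J. c j * Z t j x))" by (simp only: cn)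
    next
      show "(\<lambda>z. exp_grad J p i (\<lambda>j. sqrt 2 * z j - v t j)) \<in> borel_measurable (Pi\<^sub>M J (\<lambda>_. borel))"
        unfolding exp_grad_def[OF E]
        by (intro borel_measurable_times measurable_exp_mean measurable_exp_weight E meas i)
    next
      fix j assume j: "j \<in> J"
      show "(\<lambda>z. sqrt 2 * exp_hess J p i j (\<lambda>j. sqrt 2 * z j - v t j)) \<in> borel_measurable (Pi\<^sub>M J (\<lambda>_. borel))"
        unfolding exp_hess_def[OF E]
        by (intro borel_measurable_times borel_measurable_add borel_measurable_const measurable_exp_mean measurable_exp_weight E meas i j)
    next
      fix z :: "'i \<Rightarrow> real"
      have m: "exp_mean J p (\<lambda>j. sqrt 2 * restrict z J j - v t j) = exp_mean J p (\<lambda>j. sqrt 2 * z j - v t j)"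
        by (rule exp_mean_cong[OF E]) simp
      have w: "exp_weight J p (\<lambda>j. sqrt 2 * restrict z J j - v t j) j = exp_weight J p (\<lambda>j. sqrt 2 * z j - v t j) j" if "j \<in> J" for j
        by (rule exp_weight_cong[OF E _ that]) simp
      show "exp_grad J p i (\<lambda>j. sqrt 2 * restrict z J j - v t j) = exp_grad J p i (\<lambda>j. sqrt 2 * z j - v t j)"
        unfolding exp_grad_def[OF E] by (simp only: m w[OF i])
      show "sqrt 2 * exp_hess J p i j (\<lambda>j. sqrt 2 * restrict z J j - v t j) = sqrt 2 * exp_hess J p i j (\<lambda>j. sqrt 2 * z j - v t j)" if "j \<in> J" for j
        unfolding exp_hess_def[OF E] by (simp only: m w[OF i] w[OF that])
    next
      fix z w :: "'i \<Rightarrow> real" and s :: real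
      show "((\<lambda>s. exp_grad J p i (\<lambda>j. sqrt 2 * (z j + s * w j) - v t j)) has_real_derivative
         (\<Sum>j\<in>J. w j * (sqrt 2 * exp_hess J p i j (\<lambda>j. sqrt 2 * (z j + s * w j) - v t j)))) (at s)"
      proof -
        have "((\<lambda>s. sqrt 2 * (z j + s * w j) - v t j) has_real_derivative sqrt 2 * w j) (at s)" for j
          by (auto intro!: derivative_eq_intros)
        from exp_grad_deriv[OF E this i] show ?thesis by (simp add: mult_ac)
      qed
    next
      fix z w :: "'i \<Rightarrow> real" and j assume j: "j \<in> J"
      have d: "((\<lambda>s. sqrt 2 * (z j + s * w j) - v t j) has_real_derivative sqrt 2 * w j) (at s)" for j s
        by (auto intro!: derivative_eq_intros)
      have cm: "continuous_on UNIV (\<lambda>s. exp_mean J p (\<lambda>j. sqrt 2 * (z j + s * w j) - v t j))"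
        using DERIV_isCont[OF exp_mean_deriv[OF E d]] by (simp add: continuous_on_eq_continuous_at)
      have cw: "continuous_on UNIV (\<lambda>s. exp_weight J p (\<lambda>j. sqrt 2 * (z j + s * w j) - v t j) k)" if "k \<in> J" for k
        using DERIV_isCont[OF exp_weight_deriv[OF E d that]] by (simp add: continuous_on_eq_continuous_at)
      show "continuous_on UNIV (\<lambda>s. sqrt 2 * exp_hess J p i j (\<lambda>j. sqrt 2 * (z j + s * w j) - v t j))"
        unfolding exp_hess_def[OF E] by (intro continuous_intros cm cw i j)
    next
      fix z :: "'i \<Rightarrow> real"
      have "\<bar>exp_grad J p i (\<lambda>j. sqrt 2 * z j - v t j)\<bar> \<le> C * exp ?V * exp (sqrt 2 * (\<Sum>j\<in>J. \<bar>z j\<bar>))"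
        using order_trans[OF exp_grad_bound[OF E i] eb[unfolded C_def]] by (simp only: C_def)
      also have "\<dots> \<le> ?K * exp (sqrt 2 * (\<Sum>j\<in>J. \<bar>z j\<bar>))"
      proof (rule mult_right_mono)
        have "1 * (1 * (C * exp ?V)) \<le> ?K" using C0 s2 by (intro mult_mono) auto
        then show "C * exp ?V \<le> ?K" by simp
      qed simp
      finally show "\<bar>exp_grad J p i (\<lambda>j. sqrt 2 * z j - v t j)\<bar> \<le> ?K * exp (sqrt 2 * (\<Sum>j\<in>J. \<bar>z j\<bar>))" .
    next
      fix j and z :: "'i \<Rightarrow> real" assume j: "j \<in> J"
      have "\<bar>exp_hess J p i j (\<lambda>j. sqrt 2 * z j - v t j)\<bar> \<le> (1 + 2 * \<bar>p\<bar>) * (C * exp (\<Sum>j\<in>J. \<bar>sqrt 2 * z j - v t j\<bar>))"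
        using exp_hess_bound[OF E i j] by (simp only: C_def)
      also have "\<dots> \<le> (1 + 2 * \<bar>p\<bar>) * (C * exp ?V * exp (sqrt 2 * (\<Sum>j\<in>J. \<bar>z j\<bar>)))"
        by (intro mult_left_mono eb) auto
      finally have "sqrt 2 * \<bar>exp_hess J p i j (\<lambda>j. sqrt 2 * z j - v t j)\<bar> \<le> sqrt 2 * ((1 + 2 * \<bar>p\<bar>) * (C * exp ?V * exp (sqrt 2 * (\<Sum>j\<in>J. \<bar>z j\<bar>))))"
        by (rule mult_left_mono) simp
      then show "\<bar>sqrt 2 * exp_hess J p i j (\<lambda>j. sqrt 2 * z j - v t j)\<bar> \<le> ?K * exp (sqrt 2 * (\<Sum>j\<in>J. \<bar>z j\<bar>))"
        by (simp add: abs_mult mult.assoc)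
    qed simp
    then show ?thesis using cov[OF i] by (simp add: y_def[abs_def])
  qed

  define W where "W t x = exp_mean J p (y t x) * (\<Sum>i\<in>J. \<Sum>j\<in>J. exp_weight J p (y t x) i * exp_weight J p (y t x) j *
     ((B i i + B j j - 2 * B i j) - (A i i + A j j - 2 * A i j)))" for t x
  \<comment> \<open>The comparison of increments enters here.\<close>
  have W0: "0 \<le> W t x" for t x
    unfolding W_def using le exp_weight_nonneg[OF E] exp_mean_pos[OF E, of "y t x"]
    by (intro mult_nonneg_nonneg sum_nonneg) auto
  have Ug_int: "integrable P (\<lambda>x. U t i x * exp_grad J p i (y t x))" if i: "i \<in> J" for t i
  proof -
    \<comment> \<open>Solving the definition of \<open>y'\<close> for \<open>U\<close> reduces
      integrability to bounds already established.\<close>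
    have "U t i x * exp_grad J p i (y t x) = (exp_grad J p i (y t x) * y' t x i + v' t i * exp_grad J p i (y t x)) / sqrt 2" for x
      by (simp add: y'_def algebra_simps)
    moreover have "integrable P (\<lambda>x. exp_grad J p i (y t x) * y' t x i)"
    proof (rule bound_int)
      show "(\<lambda>x. exp_grad J p i (y t x) * y' t x i) \<in> borel_measurable P" by (intro borel_measurable_times gm ym' i)
      have "\<bar>exp_grad J p i (y t x) * y' t x i\<bar> \<le> (C * exp Q * exp (sqrt 2 * S x)) * ((1 + 2 * Q) * exp (sqrt 2 * S x))" for x
        unfolding abs_mult by (intro mult_mono gb yb' i) (use C0 in auto)
      also have "(C * exp Q * exp (sqrt 2 * S x)) * ((1 + 2 * Q) * exp (sqrt 2 * S x)) = (C * exp Q * (1 + 2 * Q)) * exp (2 * sqrt 2 * S x)" for x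
      proof -
        have "exp (2 * sqrt 2 * S x) = exp (sqrt 2 * S x) * exp (sqrt 2 * S x)" by (simp add: exp_add[symmetric])
        then show ?thesis by simp
      qed
      finally show "\<bar>exp_grad J p i (y t x) * y' t x i\<bar> \<le> (C * exp Q * (1 + 2 * Q)) * exp (2 * sqrt 2 * S x)" for x .
    qed
    ultimately show ?thesis using g_int[OF i] by simp
  qed
  have h'_eq: "(\<integral>x. h' t x \<partial>P) = (p - 1) * (sin t * cos t * (\<integral>x. W t x \<partial>P))" for t
  proof -
    let ?s = "sin t * cos t"
    define D where "D i j = B i j - A i j" for i j
    have "(\<integral>x. h' t x \<partial>P) = (\<integral>x. (\<Sum>i\<in>J. sqrt 2 * (U t i x * exp_grad J p i (y t x)) - v' t i * exp_grad J p i (y t x)) \<partial>P)"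
      unfolding h'_def y'_def by (intro Bochner_Integration.integral_cong refl sum.cong) (simp add: algebra_simps)
    also have "\<dots> = (\<Sum>i\<in>J. sqrt 2 * (\<integral>x. U t i x * exp_grad J p i (y t x) \<partial>P) - v' t i * (\<integral>x. exp_grad J p i (y t x) \<partial>P))"
      using Ug_int g_int by (simp add: Bochner_Integration.integral_sum)
    also have "\<dots> = (\<Sum>i\<in>J. (\<Sum>j\<in>J. 2 * ?s * D i j * (\<integral>x. exp_hess J p i j (y t x) \<partial>P)) - 2 * ?s * D i i * (\<integral>x. exp_grad J p i (y t x) \<partial>P))"
    proof (intro sum.cong refl)
      fix i assume i: "i \<in> J"
      have "sqrt 2 * (\<integral>x. U t i x * exp_grad J p i (y t x) \<partial>P) = (\<Sum>j\<in>J. 2 * ?s * D i j * (\<integral>x. exp_hess J p i j (y t x) \<partial>P))"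
        unfolding stein[OF i] sum_distrib_left D_def
      proof (intro sum.cong refl)
        fix j
        have "sqrt 2 * (a * (sqrt 2 * b)) = (sqrt 2 * sqrt 2) * (a * b)" for a b :: real by (simp only: mult_ac)
        then show "sqrt 2 * (?s * (B i j - A i j) * (sqrt 2 * (\<integral>x. exp_hess J p i j (y t x) \<partial>P))) = 2 * ?s * (B i j - A i j) * (\<integral>x. exp_hess J p i j (y t x) \<partial>P)"
          by simp
      qed
      then show "sqrt 2 * (\<integral>x. U t i x * exp_grad J p i (y t x) \<partial>P) - v' t i * (\<integral>x. exp_grad J p i (y t x) \<partial>P)
        = (\<Sum>j\<in>J. 2 * ?s * D i j * (\<integral>x. exp_hess J p i j (y t x) \<partial>P)) - 2 * ?s * D i i * (\<integral>x. exp_grad J p i (y t x) \<partial>P)"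
        by (simp add: v'_def D_def)
    qed
    also have "\<dots> = (\<integral>x. (\<Sum>i\<in>J. (\<Sum>j\<in>J. 2 * ?s * D i j * exp_hess J p i j (y t x)) - 2 * ?s * D i i * exp_grad J p i (y t x)) \<partial>P)"
      using h_int g_int by (simp add: Bochner_Integration.integral_sum)
    also have "\<dots> = (\<integral>x. (p - 1) * (?s * W t x) \<partial>P)"
    proof (intro Bochner_Integration.integral_cong refl)
      fix x
      let ?F = "exp_mean J p (y t x)" and ?w = "exp_weight J p (y t x)"
      let ?a = "\<Sum>i\<in>J. ?w i * D i i" and ?b = "\<Sum>i\<in>J. \<Sum>j\<in>J. ?w i * ?w j * D i j"
      have 1: "(\<Sum>j\<in>J. 2 * ?s * D i j * exp_hess J p i j (y t x)) = 2 * ?s * ?F * ((1 - p) * (\<Sum>j\<in>J. ?w i * ?w j * D i j) + p * (?w i * D i i))" if "i \<in> J" for i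
      proof -
        have "(\<Sum>j\<in>J. 2 * ?s * D i j * exp_hess J p i j (y t x))
          = (\<Sum>j\<in>J. 2 * ?s * ?F * ((1 - p) * (?w i * ?w j * D i j) + (if i = j then p * (?w i * D i i) else 0)))"
          by (intro sum.cong refl) (auto simp: exp_hess_def[OF E] algebra_simps)
        also have "\<dots> = 2 * ?s * ?F * ((1 - p) * (\<Sum>j\<in>J. ?w i * ?w j * D i j) + p * (?w i * D i i))"
          using that J by (simp add: sum_distrib_left[symmetric] sum.distrib)
        finally show ?thesis .
      qed
      \<comment> \<open>The Hessian diagonal gives \<open>?w i * D i i\<close> the coefficient
        \<open>p\<close>, and the drift subtracts 1; now both coefficients are multiples of
        \<open>p - 1\<close>.\<close>
      have "(\<Sum>i\<in>J. (\<Sum>j\<in>J. 2 * ?s * D i j * exp_hess J p i j (y t x)) - 2 * ?s * D i i * exp_grad J p i (y t x))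
        = (\<Sum>i\<in>J. 2 * ?s * ?F * ((1 - p) * (\<Sum>j\<in>J. ?w i * ?w j * D i j) + (p - 1) * (?w i * D i i)))"
      proof (intro sum.cong refl)
        fix i assume i: "i \<in> J"
        show "(\<Sum>j\<in>J. 2 * ?s * D i j * exp_hess J p i j (y t x)) - 2 * ?s * D i i * exp_grad J p i (y t x)
          = 2 * ?s * ?F * ((1 - p) * (\<Sum>j\<in>J. ?w i * ?w j * D i j) + (p - 1) * (?w i * D i i))"
          unfolding 1[OF i] exp_grad_def[OF E] by (simp add: algebra_simps)
      qed
      also have "\<dots> = 2 * ?s * ?F * ((1 - p) * ?b + (p - 1) * ?a)"
        by (simp only: sum_distrib_left[symmetric] sum.distrib)
      also have "\<dots> = (p - 1) * (?s * (?F * (2 * ?a - 2 * ?b)))" by (simp add: algebra_simps)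
      also have "?F * (2 * ?a - 2 * ?b) = W t x"
      proof -
        \<comment> \<open>The weights sum to 1, so a single sum of variances can be spread over a
          second index; this is how variances and covariances combine into variances of
          increments.\<close>
        have "(\<Sum>i\<in>J. \<Sum>j\<in>J. ?w i * ?w j * ((B i i + B j j - 2 * B i j) - (A i i + A j j - 2 * A i j)))
          = (\<Sum>i\<in>J. \<Sum>j\<in>J. ?w i * D i i * ?w j + ?w i * (?w j * D j j) - 2 * (?w i * ?w j * D i j))"
          by (intro sum.cong refl) (simp add: D_def algebra_simps)
        also have "\<dots> = (\<Sum>i\<in>J. \<Sum>j\<in>J. ?w i * D i i * ?w j) + (\<Sum>i\<in>J. \<Sum>j\<in>J. ?w i * (?w j * D j j)) - 2 * ?b"
          by (simp only: sum.distrib sum_subtractf sum_distrib_left)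
        also have "(\<Sum>i\<in>J. \<Sum>j\<in>J. ?w i * D i i * ?w j) = ?a"
          by (simp only: sum_distrib_left[symmetric] exp_weight_sum[OF E] mult_1_right)
        also have "(\<Sum>i\<in>J. \<Sum>j\<in>J. ?w i * (?w j * D j j)) = ?a"
          by (simp only: sum_distrib_left[symmetric] sum_distrib_right[symmetric] exp_weight_sum[OF E] mult_1_left)
        finally show ?thesis unfolding W_def by simp
      qed
      finally show "(\<Sum>i\<in>J. (\<Sum>j\<in>J. 2 * ?s * D i j * exp_hess J p i j (y t x)) - 2 * ?s * D i i * exp_grad J p i (y t x)) = (p - 1) * (?s * W t x)" .
    qed
    finally show ?thesis by simp
  qed
  \<comment> \<open>The derivative of this multiple carries \<open>(p - 1)\<^sup>2\<close>, so the
    sign of \<open>p - 1\<close> does not matter. On \<open>[0, pi / 2]\<close> both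
    \<open>sin\<close> and \<open>cos\<close> are nonnegative, and the endpoints give
    \<open>X\<close> and \<open>Y\<close>.\<close>
  have "(p - 1) * (\<integral>x. exp_mean J p (y 0 x) \<partial>P) \<le> (p - 1) * (\<integral>x. exp_mean J p (y (pi / 2) x) \<partial>P)"
  proof (rule DERIV_nonneg_imp_nondecreasing[where a=0 and b="pi / 2" and f="\<lambda>t. (p - 1) * (\<integral>x. exp_mean J p (y t x) \<partial>P)"])
    show "0 \<le> pi / 2" by simp
    fix t assume t: "0 \<le> t" "t \<le> pi / 2"
    have "0 \<le> sin t" "0 \<le> cos t" using t by (auto intro!: sin_ge_zero cos_ge_zero)
    moreover have "0 \<le> (\<integral>x. W t x \<partial>P)" using W0 by (intro integral_nonneg_AE) auto
    ultimately have "0 \<le> (p - 1)\<^sup>2 * (sin t * cos t * (\<integral>x. W t x \<partial>P))" by (intro mult_nonneg_nonneg) auto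
    then have "0 \<le> (p - 1) * ((p - 1) * (sin t * cos t * (\<integral>x. W t x \<partial>P)))"
      by (simp add: power2_eq_square mult.assoc)
    then show "\<exists>y'. ((\<lambda>t. (p - 1) * (\<integral>x. exp_mean J p (y t x) \<partial>P)) has_real_derivative y') (at t) \<and> 0 \<le> y'"
      using DERIV_cmult[OF deriv[of t], of "p - 1"] h'_eq[of t] by auto
  qed
  moreover have "y 0 x = (\<lambda>j. sqrt 2 * X j x - A j j)" "y (pi / 2) x = (\<lambda>j. sqrt 2 * Y j x - B j j)" for x
    by (simp_all add: y_def Z_def v_def fun_eq_iff)
  ultimately show ?thesis by (simp add: right_diff_distrib)
qed

section \<open>Comparison of the processes\<close>

lemma gaussian_law_centered:
  assumes g: "gaussian_law \<mu>" and mean: "(\<integral>x. x \<partial>\<mu>) = 0"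
  shows "\<exists>\<sigma>. \<mu> = centered_normal_law \<sigma>"
proof -
  interpret N: real_distribution std_normal_distribution by (rule real_dist_normal_dist)
  from g consider (point) m where "\<mu> = return borel m"
    | (density) m s where "0 < s" "\<mu> = density lborel (\<lambda>x. ennreal (normal_density m s x))"
    unfolding gaussian_law_def by blast
  then show ?thesis
  proof cases
    case point
    then have "m = 0" using mean by (simp add: integral_return)
    moreover have "distr std_normal_distribution borel (\<lambda>x. 0 * x) = return borel (0 :: real)"
      unfolding mult_zero_left by (rule N.distr_const) simp
    ultimately have "\<mu> = centered_normal_law 0"
      by (simp only: centered_normal_law_def point)
    then show ?thesis ..
  next
    case density
    have "(\<integral>x. x \<partial>\<mu>) = m"
      unfolding density using integral_normal_moment_nz_1[OF density(1), of m] by (subst integral_density) auto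
    then have m: "m = 0" using mean by simp
    have "distributed std_normal_distribution lborel (\<lambda>x. x) std_normal_density"
      unfolding distributed_def by (auto simp: distr_id2)
    from N.normal_density_affine[OF this _ less_imp_neq[OF density(1), symmetric], of 0]
    have "distributed std_normal_distribution lborel (\<lambda>x. s * x) (normal_density 0 s)"
      using density(1) by simp
    then have "distr std_normal_distribution lborel (\<lambda>x. s * x) = density lborel (\<lambda>x. ennreal (normal_density 0 s x))"
      by (simp add: distributed_def)
    moreover have "distr std_normal_distribution lborel (\<lambda>x. s * x) = distr std_normal_distribution borel (\<lambda>x. s * x)"
      by (intro distr_cong) auto
    ultimately have "\<mu> = centered_normal_law s" by (simp add: centered_normal_law_def density(2) m)
    then show ?thesis ..
  qed
qed

lemma centered_gaussian_process_combination:
  assumes "prob_space M" "gaussian_process M V" "centered_process M V" "finite J"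
  shows "centered_normal M (\<lambda>\<omega>. \<Sum>t\<in>J. c t * V t \<omega>)"
proof -
  have [measurable]: "V t \<in> borel_measurable M" for t using assms(2) by (simp add: gaussian_process_def)
  have i: "integrable M (V t)" "(\<integral>\<omega>. V t \<omega> \<partial>M) = 0" for t using assms(3) by (auto simp: centered_process_def)
  have "(\<integral>x. x \<partial>distr M borel (\<lambda>\<omega>. \<Sum>t\<in>J. c t * V t \<omega>)) = (\<integral>\<omega>. (\<Sum>t\<in>J. c t * V t \<omega>) \<partial>M)"
    by (subst integral_distr) auto
  also have "\<dots> = 0" using i by simp
  finally have "\<exists>\<sigma>. distr M borel (\<lambda>\<omega>. \<Sum>t\<in>J. c t * V t \<omega>) = centered_normal_law \<sigma>"
    using assms(2,4) by (intro gaussian_law_centered) (auto simp: gaussian_process_def)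
  then show ?thesis by (simp add: centered_normal_def)
qed

section \<open>Two independent families on a product space\<close>

lemma integral_pair_product:
  fixes f :: "'a \<Rightarrow> 'c :: {real_normed_field, banach, second_countable_topology}"
  assumes "prob_space M" "prob_space N" and i: "integrable (M \<Otimes>\<^sub>M N) (\<lambda>z. f (fst z) * g (snd z))"
  shows "(\<integral>z. f (fst z) * g (snd z) \<partial>(M \<Otimes>\<^sub>M N)) = (\<integral>x. f x \<partial>M) * (\<integral>y. g y \<partial>N)"
proof -
  interpret M: prob_space M by fact
  interpret N: prob_space N by fact
  interpret P: pair_prob_space M N ..
  show ?thesis using P.integral_fst'[OF i] by simp
qed

text \<open>Under the product measure the summands are independent: characteristic functions
  multiply, hence variances add and the parameter is \<open>sqrt (a + b)\<close>.\<close>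

lemma centered_normal_pair_add:
  assumes M: "prob_space M" and N: "prob_space N" and f: "centered_normal M f" and g: "centered_normal N g"
  shows "centered_normal (M \<Otimes>\<^sub>M N) (\<lambda>z. f (fst z) + g (snd z))"
proof -
  interpret M: prob_space M by fact
  interpret N: prob_space N by fact
  interpret P: pair_prob_space M N ..
  have [measurable]: "f \<in> borel_measurable M" "g \<in> borel_measurable N" using f g by (auto dest: centered_normalD)
  define a where "a = (\<integral>x. (f x)\<^sup>2 \<partial>M)"
  define b where "b = (\<integral>x. (g x)\<^sup>2 \<partial>N)"
  have ab: "0 \<le> a" "0 \<le> b" by (auto simp: a_def b_def intro!: integral_nonneg_AE)
  show ?thesis
  proof (rule centered_normalI[OF P.prob_space_axioms])
    fix t
    have "(\<integral>z. iexp (t * (f (fst z) + g (snd z))) \<partial>(M \<Otimes>\<^sub>M N)) = (\<integral>z. iexp (t * f (fst z)) * iexp (t * g (snd z)) \<partial>(M \<Otimes>\<^sub>M N))"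
      by (simp add: exp_add[symmetric] distrib_left)
    also have "\<dots> = (\<integral>x. iexp (t * f x) \<partial>M) * (\<integral>y. iexp (t * g y) \<partial>N)"
      by (rule integral_pair_product[OF M N], rule P.integrable_const_bound[where B=1]) (auto simp: norm_mult)
    also have "\<dots> = complex_of_real (exp (- (t\<^sup>2 * a) / 2) * exp (- (t\<^sup>2 * b) / 2))"
      unfolding centered_normal_iexp[OF f] centered_normal_iexp[OF g] a_def b_def by (simp only: of_real_mult)
    also have "exp (- (t\<^sup>2 * a) / 2) * exp (- (t\<^sup>2 * b) / 2) = exp (- ((sqrt (a + b) * t)\<^sup>2) / 2)"
      using ab by (simp add: exp_add[symmetric] power_mult_distrib algebra_simps add_divide_distrib diff_divide_distrib)
    finally show "(\<integral>z. iexp (t * (f (fst z) + g (snd z))) \<partial>(M \<Otimes>\<^sub>M N)) = complex_of_real (exp (- ((sqrt (a + b) * t)\<^sup>2) / 2))" .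
  qed simp
qed

lemma integrable_exp_mean:
  assumes M: "prob_space M" and J: "finite J" "J \<noteq> {}" and p: "p \<noteq> 0"
    and V: "\<And>j. j \<in> J \<Longrightarrow> centered_normal M (V j)"
  shows "integrable M (\<lambda>x. exp_mean J p (\<lambda>j. sqrt 2 * V j x - b j))"
proof (rule Bochner_Integration.integrable_bound)
  note [measurable] = centered_normalD[OF V]
  let ?K = "exp \<bar>ln (card J) / p\<bar> * exp (\<Sum>j\<in>J. \<bar>b j\<bar>)"
  show "integrable M (\<lambda>x. ?K * exp (sqrt 2 * (\<Sum>j\<in>J. \<bar>V j x\<bar>)))"
    by (intro integrable_mult_right integrable_exp_sum_abs J M centered_normalD V centered_normal_exp_abs)
  show "(\<lambda>x. exp_mean J p (\<lambda>j. sqrt 2 * V j x - b j)) \<in> borel_measurable M"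
    by (intro measurable_exp_mean J p) measurable
  have "\<bar>exp_mean J p (\<lambda>j. sqrt 2 * V j x - b j)\<bar> \<le> ?K * exp (sqrt 2 * (\<Sum>j\<in>J. \<bar>V j x\<bar>))" for x
  proof -
    have "(\<Sum>j\<in>J. \<bar>sqrt 2 * V j x - b j\<bar>) \<le> (\<Sum>j\<in>J. sqrt 2 * \<bar>V j x\<bar> + \<bar>b j\<bar>)"
      by (intro sum_mono order_trans[OF abs_triangle_ineq4]) (simp add: abs_mult)
    then have "exp (\<Sum>j\<in>J. \<bar>sqrt 2 * V j x - b j\<bar>) \<le> exp (\<Sum>j\<in>J. \<bar>b j\<bar>) * exp (sqrt 2 * (\<Sum>j\<in>J. \<bar>V j x\<bar>))"
      by (simp add: exp_add[symmetric] sum.distrib sum_distrib_left add.commute)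
    then have "exp \<bar>ln (card J) / p\<bar> * exp (\<Sum>j\<in>J. \<bar>sqrt 2 * V j x - b j\<bar>)
        \<le> exp \<bar>ln (card J) / p\<bar> * (exp (\<Sum>j\<in>J. \<bar>b j\<bar>) * exp (sqrt 2 * (\<Sum>j\<in>J. \<bar>V j x\<bar>)))"
      by (intro mult_left_mono) auto
    with exp_mean_bound[OF J p, of "\<lambda>j. sqrt 2 * V j x - b j"] exp_mean_pos[OF J p, of "\<lambda>j. sqrt 2 * V j x - b j"]
    show ?thesis by (simp only: abs_of_pos mult.assoc)
  qed
  then show "AE x in M. norm (exp_mean J p (\<lambda>j. sqrt 2 * V j x - b j)) \<le> norm (?K * exp (sqrt 2 * (\<Sum>j\<in>J. \<bar>V j x\<bar>)))"
    unfolding real_norm_def by (intro AE_I2) (rule order_trans[OF _ abs_ge_self])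
qed

lemma sum_coeff_single:
  fixes f :: "'i \<Rightarrow> real"
  assumes "finite J" "j \<in> J"
  shows "(\<Sum>i\<in>J. (if i = j then 1 else 0) * f i) = f j"
  using assms by (simp add: if_distrib[of "\<lambda>u. u * _"] cong: if_cong)

lemma centered_normal_diff_square:
  assumes fg: "centered_normal M f" "centered_normal M g"
  shows "(\<integral>x. (f x - g x)\<^sup>2 \<partial>M) = (\<integral>x. f x * f x \<partial>M) + (\<integral>x. g x * g x \<partial>M) - 2 * (\<integral>x. f x * g x \<partial>M)"
proof -
  have i: "integrable M (\<lambda>x. f x * f x)" "integrable M (\<lambda>x. g x * g x)" "integrable M (\<lambda>x. f x * g x)"
    by (intro integrable_mult_of_squares centered_normalD fg centered_normal_integrable(3))+
  have "(f x - g x)\<^sup>2 = f x * f x + g x * g x - 2 * (f x * g x)" for x by (simp add: power2_eq_square algebra_simps)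
  then show ?thesis using i by simp
qed

text \<open>On the product space, independence and centering make the cross covariances vanish.
  Integrals of functions of one factor agree with those on that factor, so the interpolation
  inequality can be read back on the original spaces.\<close>

lemma exp_mean_comparison:
  fixes V1 :: "'i \<Rightarrow> 'a \<Rightarrow> real" and V2 :: "'i \<Rightarrow> 'b \<Rightarrow> real"
  assumes M1: "prob_space M1" and M2: "prob_space M2" and J: "finite J" "J \<noteq> {}" and p: "p \<noteq> 0"
    and cn1: "\<And>c. centered_normal M1 (\<lambda>x. \<Sum>j\<in>J. c j * V1 j x)"
    and cn2: "\<And>c. centered_normal M2 (\<lambda>x. \<Sum>j\<in>J. c j * V2 j x)"
    and le: "\<And>i j. i \<in> J \<Longrightarrow> j \<in> J \<Longrightarrow> (\<integral>x. (V1 i x - V1 j x)\<^sup>2 \<partial>M1) \<le> (\<integral>x. (V2 i x - V2 j x)\<^sup>2 \<partial>M2)"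
  shows "0 \<le> (p - 1) * ((\<integral>x. exp_mean J p (\<lambda>j. sqrt 2 * V2 j x - (\<integral>x. (V2 j x)\<^sup>2 \<partial>M2)) \<partial>M2)
     - (\<integral>x. exp_mean J p (\<lambda>j. sqrt 2 * V1 j x - (\<integral>x. (V1 j x)\<^sup>2 \<partial>M1)) \<partial>M1))"
proof -
  interpret M1: prob_space M1 by fact
  interpret M2: prob_space M2 by fact
  interpret P: pair_prob_space M1 M2 ..
  let ?P = "M1 \<Otimes>\<^sub>M M2"
  have V1: "centered_normal M1 (V1 j)" and V2: "centered_normal M2 (V2 j)" if "j \<in> J" for j
    using cn1[of "\<lambda>i. if i = j then 1 else 0"] cn2[of "\<lambda>i. if i = j then 1 else 0"] by (simp_all add: sum_coeff_single[OF J(1) that])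
  note [measurable] = centered_normalD[OF V1] centered_normalD[OF V2]
  have cn: "centered_normal ?P (\<lambda>z. \<Sum>j\<in>J. a j * V1 j (fst z) + b j * V2 j (snd z))" for a b
    using centered_normal_pair_add[OF M1 M2 cn1[of a] cn2[of b]] by (simp add: sum.distrib)
  have X: "centered_normal ?P (\<lambda>z. V1 j (fst z))" and Y: "centered_normal ?P (\<lambda>z. V2 j (snd z))" if "j \<in> J" for j
    using cn[of "\<lambda>i. if i = j then 1 else 0" "\<lambda>_. 0"] cn[of "\<lambda>_. 0" "\<lambda>i. if i = j then 1 else 0"] by (simp_all add: sum_coeff_single[OF J(1) that])
  have int: "integrable ?P (\<lambda>z. V1 i (fst z) * V1 j (fst z))" "integrable ?P (\<lambda>z. V2 i (snd z) * V2 j (snd z))"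
     "integrable ?P (\<lambda>z. V1 i (fst z) * V2 j (snd z))" if "i \<in> J" "j \<in> J" for i j
    by (intro integrable_mult_of_squares centered_normalD X Y centered_normal_integrable(3) that)+
  have fst_int: "(\<integral>z. f (fst z) \<partial>?P) = (\<integral>x. f x \<partial>M1)" if "integrable ?P (\<lambda>z. f (fst z))" for f :: "'a \<Rightarrow> real"
    using integral_pair_product[OF M1 M2, of f "\<lambda>_. 1"] that by (simp add: M2.prob_space)
  have snd_int: "(\<integral>z. f (snd z) \<partial>?P) = (\<integral>x. f x \<partial>M2)" if "integrable ?P (\<lambda>z. f (snd z))" for f :: "'b \<Rightarrow> real"
    using integral_pair_product[OF M1 M2, of "\<lambda>_. 1" f] that by (simp add: M1.prob_space)
  have A: "(\<integral>z. V1 i (fst z) * V1 j (fst z) \<partial>?P) = (\<integral>x. V1 i x * V1 j x \<partial>M1)"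
   and B: "(\<integral>z. V2 i (snd z) * V2 j (snd z) \<partial>?P) = (\<integral>x. V2 i x * V2 j x \<partial>M2)"
   and O: "(\<integral>z. V1 i (fst z) * V2 j (snd z) \<partial>?P) = 0" if "i \<in> J" "j \<in> J" for i j
  proof -
    show "(\<integral>z. V1 i (fst z) * V1 j (fst z) \<partial>?P) = (\<integral>x. V1 i x * V1 j x \<partial>M1)" using fst_int[OF int(1)[OF that]] .
    show "(\<integral>z. V2 i (snd z) * V2 j (snd z) \<partial>?P) = (\<integral>x. V2 i x * V2 j x \<partial>M2)" using snd_int[OF int(2)[OF that]] .
    show "(\<integral>z. V1 i (fst z) * V2 j (snd z) \<partial>?P) = 0"
      using integral_pair_product[OF M1 M2 int(3)[OF that]] centered_normal_integrable(2)[OF V1[OF that(1)]] by simp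
  qed
  have le': "(\<integral>x. V1 i x * V1 i x \<partial>M1) + (\<integral>x. V1 j x * V1 j x \<partial>M1) - 2 * (\<integral>x. V1 i x * V1 j x \<partial>M1)
      \<le> (\<integral>x. V2 i x * V2 i x \<partial>M2) + (\<integral>x. V2 j x * V2 j x \<partial>M2) - 2 * (\<integral>x. V2 i x * V2 j x \<partial>M2)"
    if "i \<in> J" "j \<in> J" for i j
    using le[OF that] unfolding centered_normal_diff_square[OF V1[OF that(1)] V1[OF that(2)]] centered_normal_diff_square[OF V2[OF that(1)] V2[OF that(2)]] .
  have G1: "integrable ?P (\<lambda>z. exp_mean J p (\<lambda>j. sqrt 2 * V1 j (fst z) - b j))" and G2: "integrable ?P (\<lambda>z. exp_mean J p (\<lambda>j. sqrt 2 * V2 j (snd z) - b j))" for b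
    using integrable_exp_mean[OF P.prob_space_axioms J p, of "\<lambda>j z. V1 j (fst z)" b] integrable_exp_mean[OF P.prob_space_axioms J p, of "\<lambda>j z. V2 j (snd z)" b] X Y
    by auto
  define a where "a j = (\<integral>z. V1 j (fst z) * V1 j (fst z) \<partial>?P)" for j
  define b where "b j = (\<integral>z. V2 j (snd z) * V2 j (snd z) \<partial>?P)" for j
  have "0 \<le> (p - 1) * ((\<integral>z. exp_mean J p (\<lambda>j. sqrt 2 * V2 j (snd z) - b j) \<partial>?P) - (\<integral>z. exp_mean J p (\<lambda>j. sqrt 2 * V1 j (fst z) - a j) \<partial>?P))"
    unfolding a_def b_def
    by (rule gaussian_interpolation[OF P.prob_space_axioms J p cn O])
       (use le' in \<open>simp_all add: A B\<close>)
  also have "(\<integral>z. exp_mean J p (\<lambda>j. sqrt 2 * V2 j (snd z) - b j) \<partial>?P) = (\<integral>x. exp_mean J p (\<lambda>j. sqrt 2 * V2 j x - b j) \<partial>M2)"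
    by (rule snd_int[OF G2])
  also have "(\<integral>z. exp_mean J p (\<lambda>j. sqrt 2 * V1 j (fst z) - a j) \<partial>?P) = (\<integral>x. exp_mean J p (\<lambda>j. sqrt 2 * V1 j x - a j) \<partial>M1)"
    by (rule fst_int[OF G1])
  also have "(\<lambda>x. exp_mean J p (\<lambda>j. sqrt 2 * V1 j x - a j)) = (\<lambda>x. exp_mean J p (\<lambda>j. sqrt 2 * V1 j x - (\<integral>x. (V1 j x)\<^sup>2 \<partial>M1)))"
    by (intro ext exp_mean_cong[OF J p]) (simp add: a_def A power2_eq_square)
  also have "(\<lambda>x. exp_mean J p (\<lambda>j. sqrt 2 * V2 j x - b j)) = (\<lambda>x. exp_mean J p (\<lambda>j. sqrt 2 * V2 j x - (\<integral>x. (V2 j x)\<^sup>2 \<partial>M2)))"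
    by (intro ext exp_mean_cong[OF J p]) (simp add: b_def B power2_eq_square)
  finally show ?thesis .
qed

section \<open>Finite sets of times: maxima and minima as limits in \<open>p\<close>\<close>

lemma tendsto_exp_divide_ennreal:
  fixes a :: ennreal
  shows "(\<lambda>n. ennreal (exp (c / (real n + 2))) * a) \<longlonglongrightarrow> a"
proof -
  have "(\<lambda>n. exp (c / (real n + 2))) \<longlonglongrightarrow> exp 0"
    by (intro tendsto_exp) real_asymp
  then have "(\<lambda>n. ennreal (exp (c / (real n + 2)))) \<longlonglongrightarrow> ennreal 1" by (intro tendsto_ennrealI) simp
  from tendsto_mult_ennreal[OF this tendsto_const, of a] show ?thesis by simp
qed

text \<open>For \<open>p > 0\<close> the smooth maximum lies above the maximum and exceeds it at
  most by the factor \<open>exp (ln (card J) / p)\<close>. The comparison thus passes to maxima up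
  to this factor, which tends to 1.\<close>

lemma finite_SUP_comparison:
  fixes V1 :: "'i \<Rightarrow> 'a \<Rightarrow> real" and V2 :: "'i \<Rightarrow> 'b \<Rightarrow> real"
  assumes M1: "prob_space M1" and M2: "prob_space M2" and J: "finite J" "J \<noteq> {}"
    and cn1: "\<And>c. centered_normal M1 (\<lambda>x. \<Sum>j\<in>J. c j * V1 j x)"
    and cn2: "\<And>c. centered_normal M2 (\<lambda>x. \<Sum>j\<in>J. c j * V2 j x)"
    and le: "\<And>i j. i \<in> J \<Longrightarrow> j \<in> J \<Longrightarrow> (\<integral>x. (V1 i x - V1 j x)\<^sup>2 \<partial>M1) \<le> (\<integral>x. (V2 i x - V2 j x)\<^sup>2 \<partial>M2)"
  defines "S1 \<equiv> \<lambda>x. SUP j\<in>J. ennreal (exp (sqrt 2 * V1 j x - (\<integral>x. (V1 j x)\<^sup>2 \<partial>M1)))"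
    and "S2 \<equiv> \<lambda>x. SUP j\<in>J. ennreal (exp (sqrt 2 * V2 j x - (\<integral>x. (V2 j x)\<^sup>2 \<partial>M2)))"
  shows "(\<integral>\<^sup>+x. S1 x \<partial>M1) \<le> (\<integral>\<^sup>+x. S2 x \<partial>M2)"
proof -
  have V1: "centered_normal M1 (V1 j)" and V2: "centered_normal M2 (V2 j)" if "j \<in> J" for j
    using cn1[of "\<lambda>i. if i = j then 1 else 0"] cn2[of "\<lambda>i. if i = j then 1 else 0"] by (simp_all add: sum_coeff_single[OF J(1) that])
  note [measurable] = centered_normalD[OF V1] centered_normalD[OF V2]
  define y1 where "y1 x j = sqrt 2 * V1 j x - (\<integral>x. (V1 j x)\<^sup>2 \<partial>M1)" for x j
  define y2 where "y2 x j = sqrt 2 * V2 j x - (\<integral>x. (V2 j x)\<^sup>2 \<partial>M2)" for x j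
  have S2m: "S2 \<in> borel_measurable M2" unfolding S2_def using J by (intro borel_measurable_SUP) (auto simp: countable_finite)
  have "(\<integral>\<^sup>+x. S1 x \<partial>M1) \<le> ennreal (exp (ln (card J) / p)) * (\<integral>\<^sup>+x. S2 x \<partial>M2)" if p: "p > 1" for p
  proof -
    have p0: "p \<noteq> 0" "p > 0" using p by auto
    note pos = less_imp_le[OF exp_mean_pos[OF J p0(1)]]
    have i: "integrable M1 (\<lambda>x. exp_mean J p (y1 x))" "integrable M2 (\<lambda>x. exp_mean J p (y2 x))"
      unfolding y1_def[abs_def] y2_def[abs_def] by (intro integrable_exp_mean M1 M2 J p0 V1 V2; assumption)+
    have "(\<integral>\<^sup>+x. S1 x \<partial>M1) \<le> (\<integral>\<^sup>+x. ennreal (exp_mean J p (y1 x)) \<partial>M1)"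
      unfolding S1_def y1_def[symmetric]
      by (intro nn_integral_mono SUP_least ennreal_leI exp_mean_ge[OF J p0])
    also have "\<dots> = ennreal (\<integral>x. exp_mean J p (y1 x) \<partial>M1)"
      by (intro nn_integral_eq_integral i) (simp add: pos)
    also have "\<dots> \<le> ennreal (\<integral>x. exp_mean J p (y2 x) \<partial>M2)"
      using exp_mean_comparison[OF M1 M2 J p0(1) cn1 cn2 le] p
      by (intro ennreal_leI) (simp add: y1_def[abs_def] y2_def[abs_def] zero_le_mult_iff)
    also have "\<dots> = (\<integral>\<^sup>+x. ennreal (exp_mean J p (y2 x)) \<partial>M2)"
      by (intro nn_integral_eq_integral[symmetric] i) (simp add: pos)
    also have "\<dots> \<le> (\<integral>\<^sup>+x. ennreal (exp (ln (card J) / p)) * S2 x \<partial>M2)"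
    proof (rule nn_integral_mono)
      fix x
      have "Max (y2 x ` J) \<in> y2 x ` J" using J by simp
      then obtain k where k: "k \<in> J" "y2 x k = Max (y2 x ` J)" by auto
      have "exp_mean J p (y2 x) \<le> exp (ln (card J) / p) * exp (y2 x k)"
        by (rule exp_mean_le[OF J p0]) (use J k in auto)
      then have "ennreal (exp_mean J p (y2 x)) \<le> ennreal (exp (ln (card J) / p)) * ennreal (exp (y2 x k))"
        by (simp add: ennreal_mult[symmetric] ennreal_leI)
      also have "ennreal (exp (y2 x k)) \<le> S2 x" unfolding S2_def y2_def[symmetric] using k(1) by (rule SUP_upper)
      finally show "ennreal (exp_mean J p (y2 x)) \<le> ennreal (exp (ln (card J) / p)) * S2 x"
        by (simp add: mult_left_mono)
    qed
    also have "\<dots> = ennreal (exp (ln (card J) / p)) * (\<integral>\<^sup>+x. S2 x \<partial>M2)"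
      by (rule nn_integral_cmult[OF S2m])
    finally show ?thesis .
  qed
  \<comment> \<open>The choice \<open>p = n + 2\<close> exceeds 1 for every
    \<open>n\<close>.\<close>
  then have "(\<integral>\<^sup>+x. S1 x \<partial>M1) \<le> ennreal (exp (ln (card J) / (real n + 2))) * (\<integral>\<^sup>+x. S2 x \<partial>M2)" for n by simp
  then show ?thesis by (intro LIMSEQ_le_const[OF tendsto_exp_divide_ennreal[of "ln (card J)"]]) auto
qed

text \<open>The second conclusion prepares the passage to infinite sets of times: infima over
  growing finite sets decrease, and monotone convergence downwards needs a finite integral.\<close>

lemma finite_INF_comparison:
  fixes V1 :: "'i \<Rightarrow> 'a \<Rightarrow> real" and V2 :: "'i \<Rightarrow> 'b \<Rightarrow> real"
  assumes M1: "prob_space M1" and M2: "prob_space M2" and J: "finite J" "J \<noteq> {}"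
    and cn1: "\<And>c. centered_normal M1 (\<lambda>x. \<Sum>j\<in>J. c j * V1 j x)"
    and cn2: "\<And>c. centered_normal M2 (\<lambda>x. \<Sum>j\<in>J. c j * V2 j x)"
    and le: "\<And>i j. i \<in> J \<Longrightarrow> j \<in> J \<Longrightarrow> (\<integral>x. (V1 i x - V1 j x)\<^sup>2 \<partial>M1) \<le> (\<integral>x. (V2 i x - V2 j x)\<^sup>2 \<partial>M2)"
  defines "S1 \<equiv> \<lambda>x. INF j\<in>J. ennreal (exp (sqrt 2 * V1 j x - (\<integral>x. (V1 j x)\<^sup>2 \<partial>M1)))"
    and "S2 \<equiv> \<lambda>x. INF j\<in>J. ennreal (exp (sqrt 2 * V2 j x - (\<integral>x. (V2 j x)\<^sup>2 \<partial>M2)))"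
  shows "(\<integral>\<^sup>+x. S2 x \<partial>M2) \<le> (\<integral>\<^sup>+x. S1 x \<partial>M1)" and "(\<integral>\<^sup>+x. S1 x \<partial>M1) < \<infinity>"
proof -
  have V1: "centered_normal M1 (V1 j)" and V2: "centered_normal M2 (V2 j)" if "j \<in> J" for j
    using cn1[of "\<lambda>i. if i = j then 1 else 0"] cn2[of "\<lambda>i. if i = j then 1 else 0"] by (simp_all add: sum_coeff_single[OF J(1) that])
  note [measurable] = centered_normalD[OF V1] centered_normalD[OF V2]
  define y1 where "y1 x j = sqrt 2 * V1 j x - (\<integral>x. (V1 j x)\<^sup>2 \<partial>M1)" for x j
  define y2 where "y2 x j = sqrt 2 * V2 j x - (\<integral>x. (V2 j x)\<^sup>2 \<partial>M2)" for x j
  have S1m: "S1 \<in> borel_measurable M1" unfolding S1_def using J by (intro borel_measurable_INF) (auto simp: countable_finite)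
  have S2m: "S2 \<in> borel_measurable M2" unfolding S2_def using J by (intro borel_measurable_INF) (auto simp: countable_finite)
  have low: "ennreal (exp (ln (card J) / p)) * (INF j\<in>J. ennreal (exp (y j))) \<le> ennreal (exp_mean J p y)" if p: "p < 0" for p y
  proof -
    have "Min (y ` J) \<in> y ` J" using J by simp
    then obtain k where k: "k \<in> J" "y k = Min (y ` J)" by auto
    have "ennreal (exp (ln (card J) / p)) * (INF j\<in>J. ennreal (exp (y j))) \<le> ennreal (exp (ln (card J) / p)) * ennreal (exp (y k))"
      using k(1) by (intro mult_left_mono INF_lower) auto
    also have "\<dots> = ennreal (exp (ln (card J) / p) * exp (y k))" by (simp add: ennreal_mult)
    also have "\<dots> \<le> ennreal (exp_mean J p y)"
      by (intro ennreal_leI exp_mean_neg_ge[OF J _ p]) (use p J k in auto)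
    finally show ?thesis .
  qed
  have eq: "(\<integral>\<^sup>+x. ennreal (exp_mean J p (y1 x)) \<partial>M1) = ennreal (\<integral>x. exp_mean J p (y1 x) \<partial>M1)"
    "(\<integral>\<^sup>+x. ennreal (exp_mean J p (y2 x)) \<partial>M2) = ennreal (\<integral>x. exp_mean J p (y2 x) \<partial>M2)" if p: "p < 0" for p
  proof -
    have p0: "p \<noteq> 0" using p by auto
    show "(\<integral>\<^sup>+x. ennreal (exp_mean J p (y1 x)) \<partial>M1) = ennreal (\<integral>x. exp_mean J p (y1 x) \<partial>M1)"
      "(\<integral>\<^sup>+x. ennreal (exp_mean J p (y2 x)) \<partial>M2) = ennreal (\<integral>x. exp_mean J p (y2 x) \<partial>M2)"
      unfolding y1_def[abs_def] y2_def[abs_def]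
      by (intro nn_integral_eq_integral integrable_exp_mean M1 M2 J p0 V1 V2 AE_I2 less_imp_le[OF exp_mean_pos[OF J p0]]; assumption)+
  qed
  have "ennreal (exp (ln (card J) / p)) * (\<integral>\<^sup>+x. S2 x \<partial>M2) \<le> (\<integral>\<^sup>+x. S1 x \<partial>M1)" if p: "p < 0" for p
  proof -
    have p0: "p \<noteq> 0" using p by auto
    have "ennreal (exp (ln (card J) / p)) * (\<integral>\<^sup>+x. S2 x \<partial>M2) = (\<integral>\<^sup>+x. ennreal (exp (ln (card J) / p)) * S2 x \<partial>M2)"
      by (rule nn_integral_cmult[OF S2m, symmetric])
    also have "\<dots> \<le> (\<integral>\<^sup>+x. ennreal (exp_mean J p (y2 x)) \<partial>M2)"
      unfolding S2_def y2_def[symmetric] by (intro nn_integral_mono low p)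
    \<comment> \<open>Here \<open>p - 1\<close> is negative, so cancelling it reverses the
      comparison.\<close>
    also have "\<dots> \<le> (\<integral>\<^sup>+x. ennreal (exp_mean J p (y1 x)) \<partial>M1)"
      unfolding eq[OF p]
      using exp_mean_comparison[OF M1 M2 J p0 cn1 cn2 le] p
      by (intro ennreal_leI) (simp add: y1_def[abs_def] y2_def[abs_def] zero_le_mult_iff)
    also have "\<dots> \<le> (\<integral>\<^sup>+x. S1 x \<partial>M1)"
      unfolding S1_def y1_def[symmetric]
      by (intro nn_integral_mono INF_greatest ennreal_leI exp_mean_neg_le[OF J p0 p])
    finally show ?thesis .
  qed
  then have "ennreal (exp (ln (card J) / (- (real n + 2)))) * (\<integral>\<^sup>+x. S2 x \<partial>M2) \<le> (\<integral>\<^sup>+x. S1 x \<partial>M1)" for n by simp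
  \<comment> \<open>With the sign moved to the numerator, the factor has the form of
    \<open>tendsto_exp_divide_ennreal\<close>, where \<open>c\<close> may be negative.\<close>
  then have "ennreal (exp (- ln (card J) / (real n + 2))) * (\<integral>\<^sup>+x. S2 x \<partial>M2) \<le> (\<integral>\<^sup>+x. S1 x \<partial>M1)" for n
    by (simp only: divide_minus_right minus_divide_left)
  then show "(\<integral>\<^sup>+x. S2 x \<partial>M2) \<le> (\<integral>\<^sup>+x. S1 x \<partial>M1)"
    by (intro LIMSEQ_le_const2[OF tendsto_exp_divide_ennreal[of "- ln (card J)"]]) auto
  \<comment> \<open>The value -1 stands for any negative \<open>p\<close>: up to a positive constant
    the minimum is bounded by an integrable mean.\<close>
  have "ennreal (exp (ln (card J) / (-1))) * (\<integral>\<^sup>+x. S1 x \<partial>M1) = (\<integral>\<^sup>+x. ennreal (exp (ln (card J) / (-1))) * S1 x \<partial>M1)"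
    by (rule nn_integral_cmult[OF S1m, symmetric])
  also have "\<dots> \<le> (\<integral>\<^sup>+x. ennreal (exp_mean J (-1) (y1 x)) \<partial>M1)"
    unfolding S1_def y1_def[symmetric] by (intro nn_integral_mono low) simp
  also have "\<dots> < \<infinity>" by (subst eq) simp_all
  finally show "(\<integral>\<^sup>+x. S1 x \<partial>M1) < \<infinity>" by (auto simp: ennreal_mult_less_top)
qed

section \<open>From finite sets of times to the interval\<close>

text \<open>
  The paths bound no moment, but \<open>Var V\<^sub>t = - 2 ln (E cos V\<^sub>t)\<close>, and the cosine is bounded.
\<close>

lemma centered_normal_variance_continuous:
  assumes M: "prob_space M" and V: "\<And>t. centered_normal M (V t)"
    and cont: "\<And>\<omega>. \<omega> \<in> space M \<Longrightarrow> continuous_on UNIV (\<lambda>t. V t \<omega>)"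
  shows "continuous_on UNIV (\<lambda>t::real. \<integral>\<omega>. (V t \<omega>)\<^sup>2 \<partial>M)"
proof -
  interpret prob_space M by fact
  note [measurable] = centered_normalD[OF V]
  have char: "(\<integral>\<omega>. cos (V t \<omega>) \<partial>M) = exp (- (\<integral>\<omega>. (V t \<omega>)\<^sup>2 \<partial>M) / 2)" for t
  proof -
    have "integrable M (\<lambda>\<omega>. iexp (V t \<omega>))" by (rule integrable_const_bound[where B=1]) auto
    from integral_Re[OF this] arg_cong[OF centered_normal_iexp[OF V[of t], of 1], of Re] show ?thesis
      by (simp add: Re_exp)
  qed
  have "continuous_on UNIV (\<lambda>t. \<integral>\<omega>. cos (V t \<omega>) \<partial>M)"
    unfolding continuous_on_sequentially
  proof (intro ballI allI impI)
    fix X a assume X: "(\<forall>n. X n \<in> UNIV) \<and> X \<longlonglongrightarrow> (a::real)"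
    have "(\<lambda>n. \<integral>\<omega>. cos (V (X n) \<omega>) \<partial>M) \<longlonglongrightarrow> (\<integral>\<omega>. cos (V a \<omega>) \<partial>M)"
    proof (rule integral_dominated_convergence[where w="\<lambda>_. 1"])
      show "AE \<omega> in M. (\<lambda>n. cos (V (X n) \<omega>)) \<longlonglongrightarrow> cos (V a \<omega>)"
      proof (intro AE_I2 tendsto_cos)
        fix \<omega> assume "\<omega> \<in> space M"
        from cont[OF this] X show "(\<lambda>n. V (X n) \<omega>) \<longlonglongrightarrow> V a \<omega>"
          by (auto simp: continuous_on_sequentially comp_def)
      qed
    qed auto
    then show "((\<lambda>t. \<integral>\<omega>. cos (V t \<omega>) \<partial>M) \<circ> X) \<longlonglongrightarrow> (\<integral>\<omega>. cos (V a \<omega>) \<partial>M)" by (simp add: comp_def)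
  qed
  then have "continuous_on UNIV (\<lambda>t. -2 * ln (\<integral>\<omega>. cos (V t \<omega>) \<partial>M))"
    by (intro continuous_intros) (simp_all add: char)
  then show ?thesis by (simp add: char)
qed

text \<open>Each value on \<open>S\<close> is a limit of values on \<open>D\<close>, and weak
  inequalities survive limits. With a countable \<open>D\<close>, extrema over an interval become
  accessible to monotone convergence.\<close>

lemma SUP_INF_dense:
  fixes f :: "real \<Rightarrow> 'b :: {complete_linorder, linorder_topology}"
  assumes f: "continuous_on S f" and D: "D \<subseteq> S" "S \<subseteq> closure D"
  shows "(SUP t\<in>S. f t) = (SUP t\<in>D. f t)" and "(INF t\<in>S. f t) = (INF t\<in>D. f t)"
proof -
  have seq: "\<exists>X. (\<forall>n. X n \<in> D) \<and> (\<lambda>n. f (X n)) \<longlonglongrightarrow> f t" if t: "t \<in> S" for t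
  proof -
    obtain X where X: "\<forall>n. X n \<in> D" "X \<longlonglongrightarrow> t" using t D(2) closure_sequential by blast
    then show ?thesis using f t D(1) unfolding continuous_on_sequentially comp_def by blast
  qed
  show "(SUP t\<in>S. f t) = (SUP t\<in>D. f t)"
  proof (rule antisym)
    show "(SUP t\<in>S. f t) \<le> (SUP t\<in>D. f t)"
    proof (rule SUP_least)
      fix t assume "t \<in> S"
      with seq obtain X where X: "\<And>n. X n \<in> D" "(\<lambda>n. f (X n)) \<longlonglongrightarrow> f t" by blast
      show "f t \<le> (SUP t\<in>D. f t)"
        by (rule LIMSEQ_le_const2[OF X(2)]) (use X(1) in \<open>auto intro: SUP_upper\<close>)
    qed
  qed (rule SUP_subset_mono[OF D(1) order_refl])
  show "(INF t\<in>S. f t) = (INF t\<in>D. f t)"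
  proof (rule antisym)
    show "(INF t\<in>D. f t) \<le> (INF t\<in>S. f t)"
    proof (rule INF_greatest)
      fix t assume "t \<in> S"
      with seq obtain X where X: "\<And>n. X n \<in> D" "(\<lambda>n. f (X n)) \<longlonglongrightarrow> f t" by blast
      show "(INF t\<in>D. f t) \<le> f t"
        by (rule LIMSEQ_le_const[OF X(2)]) (use X(1) in \<open>auto intro: INF_lower\<close>)
    qed
  qed (rule INF_superset_mono[OF D(1) order_refl])
qed

text \<open>Shifting the smaller of the two times to 0 preserves the law of the increment, and
  squaring makes the order of \<open>s\<close> and \<open>t\<close> irrelevant. Hence the variogram
  appears at nonnegative times.\<close>

lemma stationary_increments_second_moment:
  assumes V: "\<And>t. V t \<in> borel_measurable M" and st: "stationary_increments M V"
  shows "(\<integral>\<omega>. (V s \<omega> - V t \<omega>)\<^sup>2 \<partial>M) = 2 * variogram M V \<bar>s - t\<bar>"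
proof -
  note [measurable] = V
  have m: "(\<lambda>\<omega> t. V (t + h) \<omega> - V h \<omega>) \<in> M \<rightarrow>\<^sub>M Pi\<^sub>M UNIV (\<lambda>_. borel)" for h
    by (rule measurable_PiM_single') (auto simp: PiE_def)
  have c: "(\<lambda>w. (w u)\<^sup>2) \<in> borel_measurable (Pi\<^sub>M UNIV (\<lambda>_. borel :: real measure))" for u :: real
    using measurable_component_singleton[of u UNIV "\<lambda>_. borel :: real measure"] by measurable
  have *: "(\<integral>\<omega>. (V (u + h) \<omega> - V h \<omega>)\<^sup>2 \<partial>M) = 2 * variogram M V u" for u h
  proof -
    have "distr M (Pi\<^sub>M UNIV (\<lambda>_. borel)) (\<lambda>\<omega> t. V (t + h) \<omega> - V h \<omega>) =
          distr M (Pi\<^sub>M UNIV (\<lambda>_. borel)) (\<lambda>\<omega> t. V t \<omega> - V 0 \<omega>)"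
      using st by (simp add: stationary_increments_def)
    from arg_cong[OF this, of "\<lambda>D. \<integral>w. (w u)\<^sup>2 \<partial>D"] show ?thesis
      using m[of h] m[of 0] c[of u] by (simp add: integral_distr variogram_def)
  qed
  show ?thesis
  proof (cases "t \<le> s")
    case True
    then show ?thesis using *[of "s - t" t] by simp
  next
    case False
    then show ?thesis using *[of "t - s" s] by (simp add: power2_commute)
  qed
qed

theorem theorem2p10:
  fixes M1 :: "'a measure" and M2 :: "'b measure"
    and V1 :: "real \<Rightarrow> 'a \<Rightarrow> real" and V2 :: "real \<Rightarrow> 'b \<Rightarrow> real"
    and T :: real
  assumes "prob_space M1" and "prob_space M2"
    and "gaussian_process M1 V1" and "centered_process M1 V1"
    and "stationary_increments M1 V1" and "continuous_paths M1 V1"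
    and "gaussian_process M2 V2" and "centered_process M2 V2"
    and "stationary_increments M2 V2" and "continuous_paths M2 V2"
    and "0 < T"
    and "\<And>t. t \<in> {0..T} \<Longrightarrow> variogram M1 V1 t \<le> variogram M2 V2 t"
  shows "inf_functional M1 V1 T \<ge> inf_functional M2 V2 T
       \<and> sup_functional M1 V1 T \<le> sup_functional M2 V2 T"
proof -
  interpret M1: prob_space M1 by fact
  interpret M2: prob_space M2 by fact
  note cn1 = centered_gaussian_process_combination[OF assms(1,3,4)]
  note cn2 = centered_gaussian_process_combination[OF assms(2,7,8)]
  have cV1: "centered_normal M1 (V1 t)" for t using cn1[of "{t}" "\<lambda>_. 1"] by simp
  have V1[measurable]: "V1 t \<in> borel_measurable M1" and V2[measurable]: "V2 t \<in> borel_measurable M2" for t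
    using assms(3,7) by (auto simp: gaussian_process_def)
  have mean: "M1.expectation (V1 t) = 0" "M2.expectation (V2 t) = 0" for t
    using assms(4,8) by (auto simp: centered_process_def)
  define f1 where "f1 t x = ennreal (exp (sqrt 2 * V1 t x - (\<integral>x. (V1 t x)\<^sup>2 \<partial>M1)))" for t x
  define f2 where "f2 t x = ennreal (exp (sqrt 2 * V2 t x - (\<integral>x. (V2 t x)\<^sup>2 \<partial>M2)))" for t x
  have [measurable]: "f1 t \<in> borel_measurable M1" for t unfolding f1_def by measurable
  \<comment> \<open>The processes are centered, so variances are second moments.\<close>
  have funs: "inf_functional M1 V1 T = (\<integral>\<^sup>+x. (INF t\<in>{0..T}. f1 t x) \<partial>M1)" "sup_functional M1 V1 T = (\<integral>\<^sup>+x. (SUP t\<in>{0..T}. f1 t x) \<partial>M1)"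
    "inf_functional M2 V2 T = (\<integral>\<^sup>+x. (INF t\<in>{0..T}. f2 t x) \<partial>M2)" "sup_functional M2 V2 T = (\<integral>\<^sup>+x. (SUP t\<in>{0..T}. f2 t x) \<partial>M2)"
    by (simp_all add: inf_functional_def sup_functional_def f1_def f2_def mean)
  have cont: "continuous_on {0..T} (\<lambda>t. f1 t x)" if "x \<in> space M1" for x
  proof -
    have "continuous_on UNIV (\<lambda>t. V1 t x)" "continuous_on UNIV (\<lambda>t. \<integral>x. (V1 t x)\<^sup>2 \<partial>M1)"
      using assms(6) that centered_normal_variance_continuous[OF assms(1) cV1] by (auto simp: continuous_paths_def)
    then have "continuous_on UNIV (\<lambda>t. f1 t x)" unfolding f1_def by (intro continuous_on_ennreal continuous_intros)
    then show ?thesis by (rule continuous_on_subset) simp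
  qed
  \<comment> \<open>The finite initial pieces \<open>J n\<close> of an enumeration of a countable
    dense set are the sets of times for the finite comparison.\<close>
  obtain D where D: "countable D" "D \<subseteq> {0..T}" "{0..T} \<subseteq> closure D" by (rule separable)
  have "D \<noteq> {}" using D(3) assms(11) by auto
  define q where "q = from_nat_into D"
  have q: "range q = D" using D(1) \<open>D \<noteq> {}\<close> by (simp add: q_def range_from_nat_into)
  define J where "J n = q ` {..n}" for n :: nat
  have J: "finite (J n)" "J n \<noteq> {}" "J n \<subseteq> {0..T}" "J n \<subseteq> J (Suc n)" for n
    using q D(2) by (auto simp: J_def)
  have UJ: "(\<Union>n. J n) = D" using q by (auto simp: J_def)
  have le: "(\<integral>x. (V1 i x - V1 j x)\<^sup>2 \<partial>M1) \<le> (\<integral>x. (V2 i x - V2 j x)\<^sup>2 \<partial>M2)" if "i \<in> J n" "j \<in> J n" for i j n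
  proof -
    have "i \<in> {0..T}" "j \<in> {0..T}" using that J(3) by blast+
    \<comment> \<open>Distances between times in \<open>[0, T]\<close> stay in the range where the
      variograms are compared.\<close>
    then have "\<bar>i - j\<bar> \<in> {0..T}" by auto
    from assms(12)[OF this] show ?thesis
      by (simp add: stationary_increments_second_moment[OF V1 assms(5)] stationary_increments_second_moment[OF V2 assms(9)])
  qed
  note SUP_le = finite_SUP_comparison[OF assms(1,2) J(1,2) cn1[OF J(1)] cn2[OF J(1)] le, folded f1_def f2_def]
  note INF_le = finite_INF_comparison[OF assms(1,2) J(1,2) cn1[OF J(1)] cn2[OF J(1)] le, folded f1_def f2_def]
  have meas: "(\<lambda>x. SUP t\<in>J n. f1 t x) \<in> borel_measurable M1" "(\<lambda>x. INF t\<in>J n. f1 t x) \<in> borel_measurable M1" for n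
    using J(1) by (auto intro!: borel_measurable_SUP borel_measurable_INF simp: countable_finite)
  have "(\<integral>\<^sup>+x. (SUP t\<in>{0..T}. f1 t x) \<partial>M1) = (\<integral>\<^sup>+x. (SUP n. SUP t\<in>J n. f1 t x) \<partial>M1)"
  proof (rule nn_integral_cong)
    fix x assume "x \<in> space M1"
    from SUP_INF_dense(1)[OF cont[OF this] D(2,3)] show "(SUP t\<in>{0..T}. f1 t x) = (SUP n. SUP t\<in>J n. f1 t x)"
      by (simp add: UJ[symmetric] SUP_UNION)
  qed
  also have "\<dots> = (SUP n. \<integral>\<^sup>+x. (SUP t\<in>J n. f1 t x) \<partial>M1)"
    by (rule nn_integral_monotone_convergence_SUP[OF _ meas(1)])
       (intro incseq_SucI le_funI SUP_subset_mono J(4) order_refl)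
  \<comment> \<open>On the \<open>f2\<close> side the finite set is enlarged to the whole interval
    at once, so the limit is taken on the \<open>f1\<close> side.\<close>
  also have "\<dots> \<le> (\<integral>\<^sup>+x. (SUP t\<in>{0..T}. f2 t x) \<partial>M2)"
    by (intro SUP_least order_trans[OF SUP_le] nn_integral_mono SUP_subset_mono J(3) order_refl)
  finally have sup: "(\<integral>\<^sup>+x. (SUP t\<in>{0..T}. f1 t x) \<partial>M1) \<le> (\<integral>\<^sup>+x. (SUP t\<in>{0..T}. f2 t x) \<partial>M2)" .
  have "(\<integral>\<^sup>+x. (INF t\<in>{0..T}. f2 t x) \<partial>M2) \<le> (INF n. \<integral>\<^sup>+x. (INF t\<in>J n. f1 t x) \<partial>M1)"
    by (intro INF_greatest order_trans[OF _ INF_le(1)] nn_integral_mono INF_superset_mono J(3) order_refl)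
  \<comment> \<open>A decreasing limit; finiteness of the integrals is
    \<open>INF_le(2)\<close>.\<close>
  also have "\<dots> = (\<integral>\<^sup>+x. (INF n. INF t\<in>J n. f1 t x) \<partial>M1)"
    by (rule nn_integral_monotone_convergence_INF_decseq[symmetric, OF _ meas(2) INF_le(2)])
       (intro decseq_SucI le_funI INF_superset_mono J(4) order_refl)
  also have "\<dots> = (\<integral>\<^sup>+x. (INF t\<in>{0..T}. f1 t x) \<partial>M1)"
  proof (rule nn_integral_cong)
    fix x assume "x \<in> space M1"
    from SUP_INF_dense(2)[OF cont[OF this] D(2,3)] show "(INF n. INF t\<in>J n. f1 t x) = (INF t\<in>{0..T}. f1 t x)"
      by (simp add: UJ[symmetric]) (auto intro!: antisym INF_greatest intro: INF_lower2)
  qed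
  finally show ?thesis using sup by (simp add: funs)
qed

end
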